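(* Let $G$ be a countable 2-connected graph, and let $U\subseteq V(G)$ be infinite. Then $G$ contains, as a subgraph, a ladder, or a fan, or a subdivision of $K_{2,\omega}$, having infinitely many of its vertices in $U$.
   Context: A ray is a one-way infinite path. For vertex sets (or subgraphs, or single vertices) $A,B$, an $A$--$B$ path is a path whose first vertex only lies in $A$ and whose last vertex only lies in $B$. A ladder (i.e. a subdivision of an infinite ladder) consists of two disjoint rays $R,L$ and an infinite collection of pairwise disjoint $R$--$L$ paths. A fan (i.e. a subdivision of an infinite fan) consists of a ray $R$, a vertex $d\notin V(R)$, and an infinite collection of $d$--$R$ paths any two of which have only $d$ in common. $K_{2,\omega}$ (also written $K_{2,\infty}$) is the complete bipartite graph with sides of size $2$ and $\aleph_0$. A subdivision of a graph is obtained by replacing some of its edges by paths with the same end-vertices. *)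

theory Defs
  imports "Graph_Theory.Graph_Theory" "HOL-Library.Countable_Set"
begin

text \<open>
  A simple undirected graph, finite or infinite, is modelled as a symmetric loop-free pair digraph
  (locale \<^locale>\<open>pair_bidirected_digraph\<close>): an undirected edge is a pair of opposite arcs.
\<close>

text \<open>\<open>G\<close> has more than \<open>k\<close> vertices, and deleting fewer than \<open>k\<close> of them never disconnects it.\<close>

definition k_connected :: "nat \<Rightarrow> 'a pair_pre_digraph \<Rightarrow> bool" where
  "k_connected k G \<longleftrightarrow>
     (infinite (pverts G) \<or> k < card (pverts G)) \<and>
     (\<forall>X \<subseteq> pverts G. finite X \<and> card X < k \<longrightarrow>
        Digraph_Component.connected (with_proj G \<restriction> (pverts G - X)))"

definition path_graph :: "'a list \<Rightarrow> 'a pair_pre_digraph" where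
  "path_graph p =
     \<lparr> pverts = set p, parcs = set (vwalk_arcs p) \<union> (set (vwalk_arcs p))\<inverse> \<rparr>"

definition ray_graph :: "(nat \<Rightarrow> 'a) \<Rightarrow> 'a pair_pre_digraph" where
  "ray_graph R =
     \<lparr> pverts = range R,
       parcs = range (\<lambda>i. (R i, R (Suc i))) \<union> (range (\<lambda>i. (R i, R (Suc i))))\<inverse> \<rparr>"

definition graph_Union :: "'a pair_pre_digraph set \<Rightarrow> 'a pair_pre_digraph" where
  "graph_Union \<H> = \<lparr> pverts = (\<Union>H\<in>\<H>. pverts H), parcs = (\<Union>H\<in>\<H>. parcs H) \<rparr>"

definition is_ray :: "(nat \<Rightarrow> 'a) \<Rightarrow> 'a pair_pre_digraph \<Rightarrow> bool" where
  "is_ray R G \<longleftrightarrow> range R \<subseteq> pverts G \<and> inj R \<and> (\<forall>i. (R i, R (Suc i)) \<in> parcs G)"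

text \<open>An \<open>A\<close>--\<open>B\<close> path: only its first vertex lies in \<open>A\<close> and only its last vertex lies in \<open>B\<close>.\<close>

definition AB_path :: "'a set \<Rightarrow> 'a list \<Rightarrow> 'a set \<Rightarrow> 'a pair_pre_digraph \<Rightarrow> bool" where
  "AB_path A p B G \<longleftrightarrow> vpath p (with_proj G) \<and> set p \<inter> A = {hd p} \<and> set p \<inter> B = {last p}"

text \<open>
  Ladders, fans and subdivisions are predicates on the whole graph \<open>H\<close>: it has no vertices or edges
  besides those of its constituent rays and paths.
\<close>

definition is_ladder :: "'a pair_pre_digraph \<Rightarrow> bool" where
  "is_ladder H \<longleftrightarrow>
     (\<exists>R L P. is_ray R H \<and> is_ray L H \<and> range R \<inter> range L = {} \<and>
        infinite P \<and> (\<forall>p\<in>P. AB_path (range R) p (range L) H) \<and>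
        (\<forall>p\<in>P. \<forall>q\<in>P. p \<noteq> q \<longrightarrow> set p \<inter> set q = {}) \<and>
        H = graph_Union ({ray_graph R, ray_graph L} \<union> path_graph ` P))"

definition is_fan :: "'a pair_pre_digraph \<Rightarrow> bool" where
  "is_fan H \<longleftrightarrow>
     (\<exists>R d P. is_ray R H \<and> d \<notin> range R \<and>
        infinite P \<and> (\<forall>p\<in>P. AB_path {d} p (range R) H) \<and>
        (\<forall>p\<in>P. \<forall>q\<in>P. p \<noteq> q \<longrightarrow> set p \<inter> set q = {d}) \<and>
        H = graph_Union (insert (ray_graph R) (path_graph ` P)))"

text \<open>
  \<open>H\<close> is a subdivision of \<open>X\<close>: \<open>f\<close> places the branch vertices, and \<open>P\<close> maps every edge to the path
  replacing it (possibly a single edge). The two arcs of an undirected edge are mapped to mutually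
  reverse paths; distinct edges are mapped to paths that meet at most in common branch vertices.
  The library's \<open>subdivision\<close> cannot be used here, as it permits only finitely many new vertices.
\<close>

definition is_subdivision_of :: "'a pair_pre_digraph \<Rightarrow> 'b pair_pre_digraph \<Rightarrow> bool" where
  "is_subdivision_of H X \<longleftrightarrow>
     (\<exists>f P. inj_on f (pverts X) \<and>
        (\<forall>(u, v)\<in>parcs X. vpath (P (u, v)) (with_proj H) \<and>
           hd (P (u, v)) = f u \<and> last (P (u, v)) = f v \<and>
           P (v, u) = rev (P (u, v)) \<and>
           set (P (u, v)) \<inter> f ` pverts X = {f u, f v}) \<and>
        (\<forall>(u, v)\<in>parcs X. \<forall>(x, y)\<in>parcs X. {u, v} \<noteq> {x, y} \<longrightarrow>
           set (P (u, v)) \<inter> set (P (x, y)) \<subseteq> f ` pverts X) \<and>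
        pverts H = f ` pverts X \<union> (\<Union>e\<in>parcs X. set (P e)) \<and>
        parcs H = (\<Union>e\<in>parcs X. parcs (path_graph (P e))))"

definition K_2_omega :: "(bool + nat) pair_pre_digraph" where
  "K_2_omega =
     \<lparr> pverts = UNIV,
       parcs = range Inl \<times> range Inr \<union> range Inr \<times> range Inl \<rparr>"

end

theory Submission
  imports Defs "HOL-Library.Sublist"
begin

text \<open>
  A ladder, a fan and a subdivided \<open>K\<^sub>2\<^sub>,\<^sub>\<omega>\<close> all consist of two sides, each a ray or a single vertex, joined
  by infinitely many paths. The point is to place infinitely many vertices of \<open>U\<close> on them. What makes
  this possible is that in a 2-connected graph every vertex outside a set \<open>S\<close> of at least two
  vertices lies on an \<open>S\<close>-ear, a path that has exactly its two ends in \<open>S\<close> (\<open>ear_through\<close>).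

  Suppose first that for some finite \<open>X\<close> infinitely many components of \<open>G - X\<close> meet \<open>U\<close>. An \<open>X\<close>-ear
  through a vertex of \<open>U\<close> in each of them gives infinitely many ears with disjoint interiors, and
  since \<open>X\<close> is finite, infinitely many of them share both ends
  (\<open>finite_separator_K_2_omega\<close>).

  Otherwise a depth-first search that always stays in a component with infinitely many vertices of
  \<open>U\<close>, and always heads for the first remaining vertex of an enumeration of the countable vertex set,
  traces a ray \<open>R\<close>. It comes with shrinking sets \<open>K k\<close>, each a component after deleting
  \<open>R 0, \<dots>, R k\<close> and each containing infinitely many vertices of \<open>U\<close>, whose intersection is empty
  (\<open>vanishing_ray\<close>). Every component of \<open>G - R\<close> misses some \<open>K k\<close>; so if \<open>R\<close> contains only
  finitely many vertices of \<open>U\<close>, then infinitely many components of \<open>G - R\<close> meet \<open>U\<close>, and again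
  there are infinitely many \<open>R\<close>-ears through \<open>U\<close> with disjoint interiors. If infinitely many have both
  ends in common, they form a subdivided \<open>K\<^sub>2\<^sub>,\<^sub>\<omega>\<close>; if infinitely many have the first end in
  common and distinct second ends, they form a fan with a tail of \<open>R\<close>; if neither happens,
  infinitely many of them span segments of \<open>R\<close> that follow one another without overlapping, and
  rerouting \<open>R\<close> along them gives a ray with infinitely many vertices in \<open>U\<close> (\<open>ears_over_ray\<close>).

  It remains to treat a ray \<open>R\<close> that has infinitely many vertices in \<open>U\<close> (\<open>ray_ladder_or_fan\<close>). If
  the \<open>R\<close>-ears from one vertex of \<open>R\<close> reach arbitrarily far, a star-comb argument in the rest of the
  graph yields a fan or a ladder that contains a tail of \<open>R\<close>. If not, ears that reach as far
  as possible can be chosen greedily. Each of them starts before the previous one ends but not before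
  the last but one has ended, and they are disjoint, as two intersecting ears would combine to one
  reaching further. Following every other ear, and \<open>R\<close> in between, gives the two rays of a ladder,
  whose rungs are every other one of the remaining segments of \<open>R\<close>; one of the two choices of rungs
  catches infinitely many vertices of \<open>U\<close>.
\<close>

section \<open>Paths and ears\<close>

text \<open>
  Paths are taken over an arbitrary relation, since the star-comb argument below also needs paths in
  a non-symmetric subrelation of the adjacency relation.
\<close>

definition is_path :: "'a rel \<Rightarrow> 'a list \<Rightarrow> bool" where
  "is_path E p \<longleftrightarrow> p \<noteq> [] \<and> distinct p \<and> successively (\<lambda>x y. (x, y) \<in> E) p"

text \<open>
  Outside \<open>X\<close> this relates the pairs of vertices in the same component of the graph without \<open>X\<close>;
  being reflexive, it also relates every vertex of \<open>X\<close> to itself, and to nothing else.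
\<close>

abbreviation avoid :: "'a rel \<Rightarrow> 'a set \<Rightarrow> 'a rel" where
  "avoid E X \<equiv> (E \<inter> (- X) \<times> (- X))\<^sup>*"

definition ear :: "'a rel \<Rightarrow> 'a set \<Rightarrow> 'a list \<Rightarrow> bool" where
  "ear E S p \<longleftrightarrow> is_path E p \<and> hd p \<noteq> last p \<and> hd p \<in> S \<and> last p \<in> S \<and>
     set p \<inter> S \<subseteq> {hd p, last p}"

lemma is_path_single [simp]: "is_path E [x]"
  by (simp add: is_path_def)

lemma is_path_Nil [simp]: "\<not> is_path E []"
  by (simp add: is_path_def)

lemma is_path_append:
  assumes "xs \<noteq> []" "ys \<noteq> []"
  shows "is_path E (xs @ ys) \<longleftrightarrow>
     is_path E xs \<and> is_path E ys \<and> set xs \<inter> set ys = {} \<and> (last xs, hd ys) \<in> E"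
  using assms by (auto simp: is_path_def successively_append_iff)

lemma is_path_Cons:
  assumes "ys \<noteq> []"
  shows "is_path E (x # ys) \<longleftrightarrow> is_path E ys \<and> x \<notin> set ys \<and> (x, hd ys) \<in> E"
  using is_path_append[of "[x]" ys E] assms by auto

lemma is_path_appendD1: "is_path E (xs @ ys) \<Longrightarrow> xs \<noteq> [] \<Longrightarrow> is_path E xs"
  and is_path_appendD2: "is_path E (xs @ ys) \<Longrightarrow> ys \<noteq> [] \<Longrightarrow> is_path E ys"
  by (auto simp: is_path_def successively_append_iff)

lemma is_path_rev:
  assumes "sym E"
  shows "is_path E (rev p) \<longleftrightarrow> is_path E p"
proof -
  have "successively (\<lambda>x y. (x, y) \<in> E) (rev p) \<longleftrightarrow> successively (\<lambda>x y. (x, y) \<in> E) p"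
    unfolding successively_rev using assms by (intro successively_cong) (auto dest: symD)
  then show ?thesis by (simp add: is_path_def)
qed

lemma ear_rev: "sym E \<Longrightarrow> ear E S p \<Longrightarrow> ear E S (rev p)"
  by (auto simp: ear_def is_path_rev hd_rev last_rev)

lemma is_path_avoid:
  assumes "is_path E p" "set p \<inter> X = {}" "x \<in> set p"
  shows "(hd p, x) \<in> avoid E X"
  using assms
proof (induction p arbitrary: x rule: rev_induct)
  case (snoc y ys)
  show ?case
  proof (cases "ys = []")
    case False
    then have p: "is_path E ys" "(last ys, y) \<in> E"
      using snoc.prems(1) by (auto simp: is_path_append)
    have IH: "z \<in> set ys \<Longrightarrow> (hd ys, z) \<in> avoid E X" for z
      using snoc.IH p snoc.prems by auto
    show ?thesis
    proof (cases "x \<in> set ys")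
      case False
      then have "x = y" using snoc.prems by auto
      moreover have "(last ys, y) \<in> E \<inter> (- X) \<times> (- X)"
        using p snoc.prems \<open>ys \<noteq> []\<close> last_in_set[of ys] by (auto simp del: last_in_set)
      ultimately show ?thesis using IH[of "last ys"] \<open>ys \<noteq> []\<close>
        by (auto intro: rtrancl_into_rtrancl)
    qed (use IH \<open>ys \<noteq> []\<close> in auto)
  qed (use snoc.prems in auto)
qed simp

lemma is_path_neq_Nil: "is_path E p \<Longrightarrow> p \<noteq> []"
  by auto

text \<open>A walk from \<open>a\<close> into \<open>T\<close> can be cut at its first vertex in \<open>T\<close> and stripped of its cycles.\<close>

lemma first_hit_path:
  assumes "(a, b) \<in> avoid E X" "a \<notin> X" "b \<in> T"
  shows "\<exists>p. is_path E p \<and> hd p = a \<and> last p \<in> T \<and> set p \<inter> T \<subseteq> {last p} \<and> set p \<inter> X = {}"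
  using assms
proof (induction rule: converse_rtrancl_induct)
  case base
  then show ?case by (intro exI[of _ "[b]"]) auto
next
  case (step y z)
  then obtain p where p: "is_path E p" "hd p = z" "last p \<in> T" "set p \<inter> T \<subseteq> {last p}" "set p \<inter> X = {}"
    by auto
  have "p \<noteq> []" using p(1) by (rule is_path_neq_Nil)
  consider "y \<in> T" | "y \<notin> T" "y \<in> set p" | "y \<notin> T" "y \<notin> set p" by blast
  then show ?case
  proof cases
    case 1
    then show ?thesis using step by (intro exI[of _ "[y]"]) auto
  next
    case 2
    then obtain u v where uv: "p = u @ y # v" by (meson split_list)
    have "is_path E (y # v)"
      using p(1) is_path_appendD2[of E u "y # v"] unfolding uv by auto
    then show ?thesis
      using p(3-5) unfolding uv by (intro exI[of _ "y # v"]) auto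
  next
    case 3
    then show ?thesis
      using p step \<open>p \<noteq> []\<close> by (intro exI[of _ "y # p"]) (auto simp: is_path_Cons)
  qed
qed

text \<open>
  Together with \<open>first_hit_path\<close> this produces \<open>S\<close>--\<open>T\<close> paths: the suffix from the last vertex in
  \<open>S\<close> still has only its end in \<open>T\<close>.
\<close>

lemma last_hit_subpath:
  assumes "is_path E p" "hd p \<in> S" "last p \<in> T" "set p \<inter> T \<subseteq> {last p}"
  shows "\<exists>q. is_path E q \<and> set q \<subseteq> set p \<and> hd q \<in> S \<and> last q \<in> T \<and>
    set q \<inter> S \<subseteq> {hd q} \<and> set q \<inter> T \<subseteq> {last q}"
proof -
  have "\<exists>x\<in>set p. x \<in> S" using assms by (metis hd_in_set is_path_Nil)
  then obtain u x v where uv: "p = u @ x # v" "x \<in> S" "\<forall>y\<in>set v. y \<notin> S"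
    using split_list_last_prop[of p "\<lambda>x. x \<in> S"] by blast
  have "is_path E (x # v)"
    using assms(1) is_path_appendD2[of E u "x # v"] unfolding uv(1) by auto
  then show ?thesis using uv assms(3,4) unfolding uv(1) by (intro exI[of _ "x # v"]) auto
qed

lemma avoid_sym: "sym E \<Longrightarrow> (a, b) \<in> avoid E X \<Longrightarrow> (b, a) \<in> avoid E X"
  by (rule symD[OF sym_rtrancl]) (auto simp: sym_def)

lemma rtrancl_leaves_set:
  assumes "(a, b) \<in> r\<^sup>*" "a \<in> K" "b \<notin> K"
  shows "\<exists>x y. x \<in> K \<and> y \<notin> K \<and> (x, y) \<in> r"
  using assms by (induction rule: converse_rtrancl_induct) auto

section \<open>Ears through a given vertex\<close>

locale two_connected =
  fixes V :: "'a set" and E :: "'a rel"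
  assumes symE: "sym E"
    and E_V: "E \<subseteq> V \<times> V"
    and conn: "\<lbrakk>finite X; card X < 2; a \<in> V - X; b \<in> V - X\<rbrakk> \<Longrightarrow> (a, b) \<in> avoid E X"
begin

lemma E_sym: "(x, y) \<in> E \<Longrightarrow> (y, x) \<in> E"
  using symE by (auto dest: symD)

lemma is_path_V:
  assumes "is_path E p" "hd p \<in> V"
  shows "set p \<subseteq> V"
proof
  fix x assume "x \<in> set p"
  then have "(hd p, x) \<in> avoid E {}" using assms by (intro is_path_avoid) auto
  then show "x \<in> V" using assms(2) by (induction rule: rtrancl_induct) (use E_V in auto)
qed

text \<open>
  Induction along a path from \<open>u\<close> to \<open>S\<close>. The next vertex \<open>w\<close> of this path lies in \<open>S\<close> or on an ear.
  As \<open>w\<close> does not separate \<open>u\<close> from \<open>S\<close>, there is a path \<open>q\<close> from \<open>u\<close>, avoiding \<open>w\<close>, to \<open>S\<close> or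
  to the ear of \<open>w\<close>. One half of the old ear (or just \<open>w\<close>, if \<open>w\<close> lies in \<open>S\<close>), the edge from \<open>w\<close> to \<open>u\<close>, the path \<open>q\<close> and, if \<open>q\<close>
  ends on the other half, the rest of that half form an ear through \<open>u\<close>.
\<close>

lemma ear_through_aux:
  assumes "is_path E p" "hd p \<in> V - S" "last p \<in> S" "set p \<inter> S \<subseteq> {last p}"
    and S: "s1 \<in> S \<inter> V" "s2 \<in> S \<inter> V" "s1 \<noteq> s2"
  shows "\<exists>e. ear E S e \<and> hd p \<in> set e"
  using assms(1-4)
proof (induction p)
  case (Cons u p)
  have "p \<noteq> []" using Cons.prems(2,3) by auto
  define w where "w = hd p"
  have p: "is_path E p" "u \<notin> set p" "(u, w) \<in> E"
    using Cons.prems(1) \<open>p \<noteq> []\<close> by (auto simp: is_path_Cons w_def)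
  have u: "u \<in> V" "u \<notin> S" and w: "w \<in> V" "u \<noteq> w"
    using Cons.prems(2) E_V p \<open>p \<noteq> []\<close> by (auto simp: w_def)
  obtain s where s: "s \<in> S \<inter> V" "s \<noteq> w" using S by blast
  have us: "(u, s) \<in> avoid E {w}" using s u w by (intro conn) auto
  show ?case
  proof (cases "w \<in> S")
    case True
    obtain q where q: "is_path E q" "hd q = u" "last q \<in> S - {w}" "set q \<inter> (S - {w}) \<subseteq> {last q}"
      "w \<notin> set q"
      using first_hit_path[OF us, of "S - {w}"] s w by auto
    have "q \<noteq> []" using q(1) by auto
    have "is_path E (w # q)" using q \<open>q \<noteq> []\<close> E_sym[OF p(3)] by (simp add: is_path_Cons)
    then have "ear E S (w # q)" using q \<open>q \<noteq> []\<close> True by (auto simp: ear_def)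
    then show ?thesis using q(2) \<open>q \<noteq> []\<close> by (intro exI[of _ "w # q"]) auto
  next
    case False
    have "last p \<in> S" "set p \<inter> S \<subseteq> {last p}" using Cons.prems(3,4) \<open>p \<noteq> []\<close> by auto
    then obtain e where e: "ear E S e" "w \<in> set e"
      using Cons.IH p w False unfolding w_def by blast
    show ?thesis
    proof (cases "u \<in> set e")
      case True then show ?thesis using e by auto
    next
      case ue: False
      obtain q where q: "is_path E q" "hd q = u" "last q \<in> S \<union> set e" "last q \<noteq> w"
          "set q \<inter> (S \<union> set e - {w}) \<subseteq> {last q}" "w \<notin> set q"
        using first_hit_path[OF us, of "S \<union> set e - {w}"] s w by auto
      have "q \<noteq> []" using q(1) by auto
      \<comment> \<open>The detour along \<open>q\<close> replaces the part of the old ear behind \<open>w\<close>, unless it ends before \<open>w\<close>.\<close>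
      have detour: ?thesis if e': "ear E S e'" "set e' = set e" "e' = es @ w # et"
        and z: "last q \<notin> set es" for e' es et
      proof -
        have ne: "es \<noteq> []" "et \<noteq> []" using e'(1) False unfolding e'(3) ear_def by auto
        have pe: "is_path E (es @ w # et)" "hd es \<in> S" "last et \<in> S"
            "(set es \<union> set et) \<inter> S \<subseteq> {hd es, last et}" "hd es \<noteq> last et"
          using e'(1) ne unfolding e'(3) ear_def by auto
        have dis: "set es \<inter> set et = {}" "w \<notin> set es" "w \<notin> set et" "distinct es" "distinct et"
          using pe(1) by (auto simp: is_path_def)
        have qe: "\<And>x. x \<in> set q \<Longrightarrow> x \<in> S \<union> set es \<union> set et \<Longrightarrow> x = last q"
          using q(5,6) e'(2) unfolding e'(3) by auto
        have lq: "last q \<in> S \<union> set et" using q(3,4) z e'(2) unfolding e'(3) by auto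
        obtain e2 where e2: "set e2 \<subseteq> set et" "is_path E (q @ e2)" "last (q @ e2) \<in> S"
          "set (q @ e2) \<inter> S \<subseteq> {last (q @ e2)}" "last (q @ e2) \<notin> set es"
        proof (cases "last q \<in> set et")
          case True
          then obtain e1 e2 where et: "et = e1 @ last q # e2" by (meson split_list)
          have pth: "is_path E (last q # e2)"
            using pe(1) is_path_appendD2[of E "es @ w # e1" "last q # e2"] unfolding et by auto
          have lst: "last (q @ e2) = last et" using et by auto
          have "last q \<notin> set e2" "set e2 \<subseteq> set et" using dis(5) unfolding et by auto
          then have "set q \<inter> set e2 = {}" using qe by blast
          then have pq: "is_path E (q @ e2)"
            using pth q(1) \<open>q \<noteq> []\<close> by (cases "e2 = []") (auto simp: is_path_append is_path_Cons)
          have "set q \<inter> S \<subseteq> {last et}"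
          proof
            fix x assume x: "x \<in> set q \<inter> S"
            then have "x = last q" using qe by auto
            then show "x \<in> {last et}" using pe(4) x True z hd_in_set[OF ne(1)] by auto
          qed
          moreover have "set e2 \<inter> S \<subseteq> {last et}"
            using pe(4) dis(1) hd_in_set[OF ne(1)] \<open>set e2 \<subseteq> set et\<close> by blast
          moreover have "last et \<notin> set es" using dis(1) last_in_set[OF ne(2)] by blast
          ultimately show ?thesis using that[of e2] pq \<open>set e2 \<subseteq> set et\<close> pe(3)
            unfolding lst by auto
        next
          case False
          then show ?thesis using that[of "[]"] q(1) qe z lq by auto
        qed
        let ?e = "(es @ [w]) @ (q @ e2)"
        have "is_path E (es @ [w])"
          using is_path_appendD1[of E "es @ [w]" et] pe(1) by auto
        moreover have "set (es @ [w]) \<inter> set (q @ e2) = {}"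
          using dis qe z e2(1) q(6) by (auto; metis)
        ultimately have pth: "is_path E ?e"
          using e2(2) \<open>q \<noteq> []\<close> q(2) E_sym[OF p(3)] by (subst is_path_append) auto
        have "set es \<inter> S \<subseteq> {hd es}"
          using pe(4) dis(1) last_in_set[OF ne(2)] by blast
        then have "set ?e \<inter> S \<subseteq> {hd es, last (q @ e2)}"
          using False e2(4) by auto
        moreover have "hd ?e = hd es" "last ?e = last (q @ e2)" using ne \<open>q \<noteq> []\<close> by auto
        moreover have "hd es \<noteq> last (q @ e2)" using e2(5) hd_in_set[OF ne(1)] by metis
        ultimately have "ear E S ?e" using pth e2(3) pe(2) unfolding ear_def by metis
        then show ?thesis using q(2) hd_in_set[OF \<open>q \<noteq> []\<close>] by (intro exI[of _ ?e]) auto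
      qed
      obtain es et where et: "e = es @ w # et" using e(2) by (meson split_list)
      show ?thesis
      proof (cases "last q \<in> set es")
        case True
        then have "last q \<notin> set et" using e(1) unfolding et ear_def is_path_def by auto
        then show ?thesis
          using detour[of "rev e" "rev et" "rev es"] ear_rev[OF symE e(1)] et
          by (simp add: Un_commute)
      next
        case False
        then show ?thesis using detour[of e es et] e(1) et by auto
      qed
    qed
  qed
qed simp

lemma ear_through:
  assumes "u \<in> V - S" "s1 \<in> S \<inter> V" "s2 \<in> S \<inter> V" "s1 \<noteq> s2"
  shows "\<exists>e. ear E S e \<and> u \<in> set e"
proof -
  have "(u, s1) \<in> avoid E {}" using assms by (intro conn) auto
  then obtain p where "is_path E p" "hd p = u" "last p \<in> S" "set p \<inter> S \<subseteq> {last p}"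
    using first_hit_path[of u s1 E "{}" S] assms by auto
  then show ?thesis using ear_through_aux[of p S s1 s2] assms by auto
qed

end

section \<open>Rays assembled from paths\<close>

definition ray :: "'a rel \<Rightarrow> (nat \<Rightarrow> 'a) \<Rightarrow> bool" where
  "ray E R \<longleftrightarrow> inj R \<and> (\<forall>i. (R i, R (Suc i)) \<in> E)"

lemma ray_eq_iff: "ray E R \<Longrightarrow> R i = R j \<longleftrightarrow> i = j"
  by (auto simp: ray_def inj_eq)

lemma ray_tail: "ray E R \<Longrightarrow> ray E (\<lambda>i. R (i + k))"
  unfolding ray_def inj_def by (metis add_Suc add_right_cancel)

text \<open>
  The ray runs through the positions \<open>(m, i)\<close> of the blocks in lexicographic order. It is injective
  because the number of steps that lead to \<open>(m, i)\<close> is determined by \<open>(m, i)\<close>, as the total length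
  of the blocks before \<open>q m\<close>, plus \<open>i\<close>.
\<close>

lemma ray_concat:
  fixes q :: "nat \<Rightarrow> 'a list"
  assumes ne: "\<And>m. q m \<noteq> []" and dist: "\<And>m. distinct (q m)"
    and disj: "\<And>m n. m \<noteq> n \<Longrightarrow> set (q m) \<inter> set (q n) = {}"
    and succ: "\<And>m. successively (\<lambda>x y. (x, y) \<in> E) (q m @ [hd (q (Suc m))])"
  shows "\<exists>r. ray E r \<and> range r = (\<Union>m. set (q m))"
proof -
  define nxt where "nxt = (\<lambda>(m, i). if Suc i < length (q m) then (m, Suc i) else (Suc m, 0::nat))"
  define st where "st k = (nxt ^^ k) (0, 0)" for k
  define r where "r k = q (fst (st k)) ! snd (st k)" for k
  have st_0: "st 0 = (0, 0)" and st_Suc: "st (Suc k) = nxt (st k)" for k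
    by (simp_all add: st_def)
  have inv: "snd (st k) < length (q (fst (st k)))" for k
    by (induction k) (auto simp: st_0 st_Suc nxt_def ne split: prod.splits)
  have pos: "k = (\<Sum>j<fst (st k). length (q j)) + snd (st k)" for k
  proof (induction k)
    case (Suc k)
    obtain m i where mi: "st k = (m, i)" by (cases "st k")
    have "i < length (q m)" using inv[of k] mi by auto
    then show ?case using Suc mi by (auto simp: st_Suc nxt_def)
  qed (simp add: st_0)
  have reach: "\<exists>k. st k = (m, i)" if "i < length (q m)" for m i
    using that
  proof (induction m arbitrary: i)
    case 0
    then show ?case
    proof (induction i)
      case (Suc i)
      then obtain k where "st k = (0, i)" by auto
      then have "st (Suc k) = (0, Suc i)" using Suc.prems by (simp add: st_Suc nxt_def)
      then show ?case by blast
    qed (use st_0 in blast)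
  next
    case (Suc m)
    from Suc.prems show ?case
    proof (induction i)
      case 0
      have "length (q m) - 1 < length (q m)" using ne[of m] by (cases "q m") auto
      then obtain k where "st k = (m, length (q m) - 1)" using Suc.IH by blast
      then have "st (Suc k) = (Suc m, 0)" using ne[of m] by (auto simp: st_Suc nxt_def)
      then show ?case by blast
    next
      case (Suc i)
      then obtain k where "st k = (Suc m, i)" by auto
      then have "st (Suc k) = (Suc m, Suc i)" using Suc.prems by (simp add: st_Suc nxt_def)
      then show ?case by blast
    qed
  qed
  have r_in: "r k \<in> set (q (fst (st k)))" for k using inv[of k] by (simp add: r_def)
  have "inj r"
  proof (rule injI)
    fix k l assume kl: "r k = r l"
    then have "fst (st k) = fst (st l)" using disj r_in by (metis disjoint_iff)
    moreover from this have "snd (st k) = snd (st l)"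
      using kl inv[of k] inv[of l] dist by (simp add: r_def nth_eq_iff_index_eq)
    ultimately show "k = l" using pos[of k] pos[of l] by simp
  qed
  moreover have "(r k, r (Suc k)) \<in> E" for k
  proof -
    obtain m i where mi: "st k = (m, i)" by (cases "st k")
    let ?p = "q m @ [hd (q (Suc m))]"
    have i: "i < length (q m)" using inv[of k] mi by auto
    have "(?p ! i, ?p ! Suc i) \<in> E"
      using succ[of m] i by (simp only: successively_conv_nth) auto
    moreover have "?p ! i = r k" using mi i by (simp add: r_def nth_append)
    moreover have "?p ! Suc i = r (Suc k)"
    proof (cases "Suc i < length (q m)")
      case False
      then have "Suc i = length (q m)" using i by simp
      then show ?thesis using mi ne[of "Suc m"]
        by (simp add: r_def st_Suc nxt_def nth_append hd_conv_nth)
    qed (simp add: mi r_def st_Suc nxt_def nth_append)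
    ultimately show ?thesis by simp
  qed
  moreover have "range r = (\<Union>m. set (q m))"
  proof (intro equalityI subsetI)
    fix x assume "x \<in> (\<Union>m. set (q m))"
    then obtain m i where "i < length (q m)" "x = q m ! i" by (auto simp: in_set_conv_nth)
    moreover from this obtain k where "st k = (m, i)" using reach by blast
    ultimately have "x = r k" by (simp add: r_def)
    then show "x \<in> range r" by simp
  qed (use r_in in auto)
  ultimately show ?thesis unfolding ray_def by blast
qed

lemma is_path_segment:
  assumes "ray E R" "i < j"
  shows "is_path E (map R [i..<j])"
proof -
  have "inj R" using assms by (simp add: ray_def)
  then have "distinct (map R [i..<j])" by (auto simp: distinct_map intro: inj_on_subset)
  then show ?thesis using assms by (auto simp: is_path_def successively_conv_nth ray_def)
qed

text \<open>
  Ears over non-overlapping segments of a ray can replace these segments. This serves twice: to reroute a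
  ray through given vertices, and, with every other ear of an interleaved sequence, to obtain either
  of the two rays of a ladder.
\<close>

lemma switch_ray:
  assumes R: "ray E R"
    and J: "\<And>n. is_path E (J n)" "\<And>n. hd (J n) = R (a n)" "\<And>n. last (J n) = R (b n)"
      "\<And>n. set (J n) \<inter> range R \<subseteq> {R (a n), R (b n)}"
    and ab: "\<And>n. a n < b n" "\<And>n. b n \<le> a (Suc n)"
    and disj: "\<And>m n. m \<noteq> n \<Longrightarrow> set (J m) \<inter> set (J n) \<subseteq> range R"
  shows "\<exists>r. ray E r \<and> range r = (\<Union>n. set (J n) \<union> R ` {b n..a (Suc n)})"
proof -
  \<comment> \<open>Every block omits its end \<open>R (a (Suc n))\<close>, which is the first vertex of the next block.\<close>
  define q where "q n = butlast (J n) @ map R [b n..<a (Suc n)]" for n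
  have Jne: "J n \<noteq> []" for n using J(1)[of n] by (rule is_path_neq_Nil)
  have Jb: "J n = butlast (J n) @ [R (b n)]" for n
    using append_butlast_last_id[OF Jne[of n]] J(3) by simp
  note R_eq = ray_eq_iff[OF R]
  have distJ: "distinct (J n)" for n using J(1) by (simp add: is_path_def)
  have set_bl: "set (butlast (J n)) = set (J n) - {R (b n)}" for n
  proof -
    have "distinct (butlast (J n) @ [R (b n)])" using distJ Jb[of n] by simp
    then have "R (b n) \<notin> set (butlast (J n))" by simp
    moreover have "set (J n) = insert (R (b n)) (set (butlast (J n)))"
      using arg_cong[OF Jb[of n], of set] by simp
    ultimately show ?thesis by blast
  qed
  have bl_ne: "butlast (J n) \<noteq> []" for n
  proof
    assume "butlast (J n) = []"
    then have "hd (J n) = R (b n)" using Jb[of n] by (metis append_Nil list.sel(1))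
    then show False using J(2) ab(1)[of n] by (simp add: R_eq)
  qed
  have hd_q: "hd (q n) = R (a n)" for n
  proof -
    have "hd (J n) = hd (butlast (J n))" using Jb[of n] bl_ne[of n] by (metis hd_append2)
    then show ?thesis using bl_ne J(2) by (simp add: q_def)
  qed
  have set_q: "set (q n) = (set (J n) - {R (b n)}) \<union> R ` {b n..<a (Suc n)}" for n
    by (simp add: q_def set_bl)
  have a_mono: "a m < a n" if "m < n" for m n
    using lift_Suc_mono_less[of a m n] ab that by (meson order_less_le_trans)
  have ba: "b m \<le> a n" if "m < n" for m n
    using ab(2)[of m] a_mono[of "Suc m" n] that by (cases "Suc m = n") auto
  have idx: "i = a n \<or> i = b n" if "R i \<in> set (J n)" for i n
    using J(4)[of n] that by (auto simp: R_eq)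
  have q_disj: "set (q m) \<inter> set (q n) = {}" if mn: "m < n" for m n
  proof (rule ccontr)
    assume "set (q m) \<inter> set (q n) \<noteq> {}"
    then obtain x where x: "x \<in> set (q m)" "x \<in> set (q n)" by blast
    have sm: "a (Suc m) \<le> a n" using mn a_mono[of "Suc m" n] by (cases "Suc m = n") auto
    have "x \<in> range R" using x disj[of m n] mn unfolding set_q by auto
    then obtain i where i: "x = R i" by blast
    have "i = a m \<or> (b m \<le> i \<and> i < a (Suc m))"
      using x(1) idx[of i m] unfolding set_q i by (auto simp: R_eq)
    moreover have "i = a n \<or> (b n \<le> i \<and> i < a (Suc n))"
      using x(2) idx[of i n] unfolding set_q i by (auto simp: R_eq)
    ultimately show False using mn a_mono[OF mn] ba[OF mn] sm ab(1)[of n] ab(1)[of m] by linarith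
  qed
  have q_disj': "set (q m) \<inter> set (q n) = {}" if "m \<noteq> n" for m n
    using that q_disj[of m n] q_disj[of n m] by (cases "m < n") auto
  have q_dist: "distinct (q n)" for n
  proof -
    have "inj R" using R by (simp add: ray_def)
    then have "distinct (map R [b n..<a (Suc n)])" by (auto simp: distinct_map intro: inj_on_subset)
    moreover have "set (butlast (J n)) \<inter> R ` {b n..<a (Suc n)} = {}"
      using idx[of _ n] ab(1)[of n] unfolding set_bl by fastforce
    moreover have "distinct (butlast (J n))" using distJ[of n] by (rule distinct_butlast)
    ultimately show ?thesis unfolding q_def distinct_append set_map set_upt by blast
  qed
  have q_succ: "successively (\<lambda>x y. (x, y) \<in> E) (q n @ [hd (q (Suc n))])" for n
  proof -
    have "map R [b n..<a (Suc n)] @ [R (a (Suc n))] = R (b n) # map R [Suc (b n)..<Suc (a (Suc n))]"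
    proof -
      have "[b n..<a (Suc n)] @ [a (Suc n)] = b n # [Suc (b n)..<Suc (a (Suc n))]"
        using ab(2)[of n] upt_conv_Cons[of "b n" "Suc (a (Suc n))"] by simp
      from arg_cong[OF this, of "map R"] show ?thesis by (simp del: upt_Suc)
    qed
    then have eq: "q n @ [hd (q (Suc n))] = J n @ map R [Suc (b n)..<Suc (a (Suc n))]"
      using Jb[of n] hd_q[of "Suc n"] unfolding q_def by (metis append.assoc append_Cons append_Nil)
    show ?thesis
    proof (cases "b n = a (Suc n)")
      case True
      then show ?thesis unfolding eq using J(1)[of n] by (simp add: is_path_def)
    next
      case False
      then have lt: "Suc (b n) < Suc (a (Suc n))" using ab(2)[of n] by simp
      then have "is_path E (map R [Suc (b n)..<Suc (a (Suc n))])"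
        using R by (rule is_path_segment[rotated])
      moreover have "hd (map R [Suc (b n)..<Suc (a (Suc n))]) = R (Suc (b n))"
        using lt by (simp add: upt_conv_Cons del: upt_Suc)
      ultimately show ?thesis unfolding eq using J(1)[of n] J(3)[of n] R
        by (simp add: is_path_def successively_append_iff ray_def del: upt_Suc)
    qed
  qed
  have q_ne: "q n \<noteq> []" for n using bl_ne by (simp add: q_def)
  obtain r where r: "ray E r" "range r = (\<Union>m. set (q m))"
    using ray_concat[of q E] q_ne q_dist q_disj' q_succ by blast
  have a_in: "R (a n) \<in> set (q n)" for n
    using hd_in_set[OF q_ne[of n]] hd_q[of n] by simp
  have "(\<Union>m. set (q m)) = (\<Union>n. set (J n) \<union> R ` {b n..a (Suc n)})"
  proof (intro equalityI subsetI)
    fix x assume "x \<in> (\<Union>n. set (J n) \<union> R ` {b n..a (Suc n)})"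
    then obtain n where "x \<in> set (J n) - {R (b n)} \<or> x \<in> R ` {b n..a (Suc n)}"
      using ab(2) by fastforce
    then have "x \<in> set (q n) \<or> x = R (a (Suc n))"
      unfolding set_q by (auto simp: le_less)
    then show "x \<in> (\<Union>m. set (q m))" using a_in[of "Suc n"] by blast
  qed (force simp: set_q)
  then show ?thesis using r by auto
qed

section \<open>Building ladders, fans and subdivisions\<close>

lemma set_vwalk_arcs_subset_iff:
  "set (vwalk_arcs p) \<subseteq> E \<longleftrightarrow> successively (\<lambda>x y. (x, y) \<in> E) p"
  by (induction p rule: vwalk_arcs.induct) auto

lemma set_vwalk_arcs_verts: "set (vwalk_arcs p) \<subseteq> set p \<times> set p"
  by (induction p rule: vwalk_arcs.induct) auto

lemma vpath_with_proj_iff: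
  "vpath p (with_proj H) \<longleftrightarrow> set p \<subseteq> pverts H \<and> is_path (parcs H) p"
  by (auto simp: vpath_def vwalk_def is_path_def set_vwalk_arcs_subset_iff)

lemma is_path_mono: "is_path E p \<Longrightarrow> E \<subseteq> F \<Longrightarrow> is_path F p"
  by (auto simp: is_path_def elim!: successively_mono)

lemma is_path_path_graph: "is_path E p \<Longrightarrow> is_path (parcs (path_graph p)) p"
  using set_vwalk_arcs_subset_iff[of p "parcs (path_graph p)"]
  by (auto simp: is_path_def path_graph_def)

locale two_connected_graph =
  fixes G :: "'a pair_pre_digraph"
  assumes bidirected: "pair_bidirected_digraph G"
    and two_conn: "k_connected 2 G"
begin

lemma sym_parcs: "sym (parcs G)"
proof -
  interpret pair_bidirected_digraph G by (rule bidirected)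
  show ?thesis using pair_sym_arcs by (simp add: symmetric_def)
qed

lemma parcs_pverts: "parcs G \<subseteq> pverts G \<times> pverts G"
proof -
  interpret pair_bidirected_digraph G by (rule bidirected)
  show ?thesis using in_arcsD1 in_arcsD2 by auto
qed

sublocale two_connected "pverts G" "parcs G"
proof
  fix X :: "'a set" and a b
  assume X: "finite X" "card X < 2" and ab: "a \<in> pverts G - X" "b \<in> pverts G - X"
  let ?X = "X \<inter> pverts G"
  let ?H = "with_proj G \<restriction> (pverts G - ?X)"
  have "card ?X < 2" using X by (meson card_mono inf_le1 le_less_trans)
  then have "Digraph_Component.connected ?H"
    using two_conn X(1) unfolding k_connected_def by auto
  then have "(a, b) \<in> rtrancl_on (pverts G - ?X) ((arcs_ends ?H)\<^sup>s)"
    using ab unfolding connected_conv by auto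
  then show "(a, b) \<in> avoid (parcs G) X"
  proof (induction rule: rtrancl_on_induct)
    case (step y z)
    have "(arcs_ends ?H)\<^sup>s \<subseteq> parcs G"
      using sym_parcs by (auto simp: symcl_def arcs_ends_def arc_to_ends_def induce_subgraph_def sym_def)
    then have "(y, z) \<in> parcs G \<inter> (- X) \<times> (- X)" using step by auto
    then show ?case using step.IH by (rule rtrancl_into_rtrancl[rotated])
  qed simp
qed (use sym_parcs parcs_pverts in auto)

lemma subgraphI:
  assumes "pverts H \<subseteq> pverts G" "parcs H \<subseteq> parcs G" "parcs H \<subseteq> pverts H \<times> pverts H"
  shows "subgraph (with_proj H) (with_proj G)"
proof -
  interpret pair_bidirected_digraph G by (rule bidirected)
  have "wf_digraph (with_proj G)" by unfold_locales
  moreover have "wf_digraph (with_proj H)" using assms(3) by unfold_locales auto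
  ultimately show ?thesis using assms by (auto simp: subgraph_def compatible_def)
qed

lemma path_graph_in:
  assumes "is_path (parcs G) p" "set p \<subseteq> pverts G"
  shows "pverts (path_graph p) \<subseteq> pverts G" "parcs (path_graph p) \<subseteq> parcs G"
    "parcs (path_graph p) \<subseteq> pverts (path_graph p) \<times> pverts (path_graph p)"
  using assms set_vwalk_arcs_verts[of p] sym_parcs
  by (auto simp: path_graph_def is_path_def set_vwalk_arcs_subset_iff[symmetric] dest: symD)

lemma ray_in_pverts:
  assumes "ray (parcs G) R"
  shows "range R \<subseteq> pverts G"
  using assms parcs_pverts by (auto simp: ray_def)

lemma ray_graph_in:
  assumes "ray (parcs G) R"
  shows "pverts (ray_graph R) \<subseteq> pverts G" "parcs (ray_graph R) \<subseteq> parcs G"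
    "parcs (ray_graph R) \<subseteq> pverts (ray_graph R) \<times> pverts (ray_graph R)"
  using assms ray_in_pverts[OF assms] sym_parcs
  by (auto simp: ray_graph_def ray_def dest: symD)

lemma is_rayI:
  assumes "ray (parcs G) R" "ray_graph R \<in> \<H>"
  shows "is_ray R (graph_Union \<H>)"
proof -
  have "pverts (ray_graph R) \<subseteq> pverts (graph_Union \<H>)" "parcs (ray_graph R) \<subseteq> parcs (graph_Union \<H>)"
    using assms(2) by (auto simp: graph_Union_def)
  then show ?thesis using assms(1) unfolding is_ray_def ray_def by (auto simp: ray_graph_def)
qed

lemma graph_Union_subgraph:
  assumes "\<And>X. X \<in> \<H> \<Longrightarrow> (\<exists>R. ray (parcs G) R \<and> X = ray_graph R) \<or>
    (\<exists>p. is_path (parcs G) p \<and> set p \<subseteq> pverts G \<and> X = path_graph p)"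
  shows "subgraph (with_proj (graph_Union \<H>)) (with_proj G)"
proof -
  have "pverts X \<subseteq> pverts G \<and> parcs X \<subseteq> parcs G \<and> parcs X \<subseteq> pverts X \<times> pverts X" if "X \<in> \<H>" for X
    using assms[OF that] ray_graph_in path_graph_in by (elim disjE exE conjE) simp_all
  then show ?thesis by (intro subgraphI) (fastforce simp: graph_Union_def)+
qed

lemma vpath_graph_Union:
  assumes "is_path (parcs G) p" "path_graph p \<in> \<H>"
  shows "vpath p (with_proj (graph_Union \<H>))"
proof -
  have "set p \<subseteq> pverts (graph_Union \<H>)"
    using assms(2) by (force simp: graph_Union_def path_graph_def)
  moreover have "is_path (parcs (graph_Union \<H>)) p"
    using is_path_path_graph[OF assms(1)] by (rule is_path_mono) (use assms(2) in \<open>auto simp: graph_Union_def\<close>)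
  ultimately show ?thesis by (simp add: vpath_with_proj_iff)
qed

lemma ladderI:
  assumes "ray (parcs G) R" "ray (parcs G) L" "range R \<inter> range L = {}" "infinite P"
    and P: "\<And>p. p \<in> P \<Longrightarrow> is_path (parcs G) p \<and> set p \<subseteq> pverts G \<and>
      set p \<inter> range R = {hd p} \<and> set p \<inter> range L = {last p}"
    and disj: "\<And>p q. p \<in> P \<Longrightarrow> q \<in> P \<Longrightarrow> p \<noteq> q \<Longrightarrow> set p \<inter> set q = {}"
  shows "\<exists>H. subgraph (with_proj H) (with_proj G) \<and> is_ladder H \<and>
    range R \<union> range L \<union> (\<Union>p\<in>P. set p) \<subseteq> pverts H"
proof -
  let ?\<H> = "{ray_graph R, ray_graph L} \<union> path_graph ` P"
  let ?H = "graph_Union ?\<H>"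
  have "subgraph (with_proj ?H) (with_proj G)"
    using assms(1,2) P by (intro graph_Union_subgraph) (elim UnE insertE imageE emptyE; blast)
  moreover have "is_ladder ?H"
    unfolding is_ladder_def AB_path_def
    using assms(3,4) P disj is_rayI[OF assms(1), of ?\<H>] is_rayI[OF assms(2), of ?\<H>]
      vpath_graph_Union[of _ ?\<H>]
    by (intro exI[of _ R] exI[of _ L] exI[of _ P]) auto
  moreover have "range R \<union> range L \<union> (\<Union>p\<in>P. set p) \<subseteq> pverts ?H"
    by (auto simp: graph_Union_def ray_graph_def path_graph_def)
  ultimately show ?thesis by blast
qed

lemma fanI:
  assumes "ray (parcs G) R" "d \<notin> range R" "infinite P"
    and P: "\<And>p. p \<in> P \<Longrightarrow> is_path (parcs G) p \<and> set p \<subseteq> pverts G \<and>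
      hd p = d \<and> set p \<inter> range R = {last p}"
    and disj: "\<And>p q. p \<in> P \<Longrightarrow> q \<in> P \<Longrightarrow> p \<noteq> q \<Longrightarrow> set p \<inter> set q \<subseteq> {d}"
  shows "\<exists>H. subgraph (with_proj H) (with_proj G) \<and> is_fan H \<and>
    range R \<union> (\<Union>p\<in>P. set p) \<subseteq> pverts H"
proof -
  let ?\<H> = "insert (ray_graph R) (path_graph ` P)"
  let ?H = "graph_Union ?\<H>"
  have d: "d \<in> set p" if "p \<in> P" for p
    using P[OF that] is_path_neq_Nil[of "parcs G" p] hd_in_set[of p] by auto
  have "subgraph (with_proj ?H) (with_proj G)"
    using assms(1) P by (intro graph_Union_subgraph) (elim UnE insertE imageE emptyE; blast)
  moreover have "is_fan ?H"
    unfolding is_fan_def AB_path_def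
  proof (intro exI[of _ R] exI[of _ d] exI[of _ P] conjI ballI impI)
    show "set p \<inter> set q = {d}" if "p \<in> P" "q \<in> P" "p \<noteq> q" for p q
      using disj[OF that] d that by blast
    show "set p \<inter> {d} = {hd p}" if "p \<in> P" for p using P[OF that] d[OF that] by auto
  qed (use assms is_rayI[OF assms(1), of ?\<H>] vpath_graph_Union[of _ ?\<H>] in auto)
  moreover have "range R \<union> (\<Union>p\<in>P. set p) \<subseteq> pverts ?H"
    by (auto simp: graph_Union_def ray_graph_def path_graph_def)
  ultimately show ?thesis by blast
qed

text \<open>
  Infinitely many internally disjoint \<open>c\<close>--\<open>d\<close> paths are a subdivision of \<open>K\<^sub>2\<^sub>,\<^sub>\<omega>\<close> as soon as none of
  them is a single edge: an arbitrary inner vertex \<open>u n\<close> of the \<open>n\<close>-th path is the branch vertex in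
  which its two subdivided edges meet.
\<close>

lemma K_2_omega_subdivisionI:
  fixes q :: "nat \<Rightarrow> 'a list"
  assumes "c \<noteq> d"
    and q: "\<And>n. is_path (parcs G) (q n)" "\<And>n. set (q n) \<subseteq> pverts G"
      "\<And>n. hd (q n) = c" "\<And>n. last (q n) = d"
    and u: "\<And>n. u n \<in> set (q n)" "\<And>n. u n \<notin> {c, d}"
    and disj: "\<And>m n. m \<noteq> n \<Longrightarrow> set (q m) \<inter> set (q n) \<subseteq> {c, d}"
  shows "\<exists>H. subgraph (with_proj H) (with_proj G) \<and> is_subdivision_of H K_2_omega \<and>
    (\<Union>n. set (q n)) \<subseteq> pverts H"
proof -
  have "\<exists>xs ys. q n = xs @ u n # ys" for n using u(1)[of n] by (rule split_list)
  then obtain xs ys where qn: "\<And>n. q n = xs n @ u n # ys n" by metis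
  define f where "f v = (case v of Inl b \<Rightarrow> if b then c else d | Inr n \<Rightarrow> u n)" for v :: "bool + nat"
  \<comment> \<open>The halves lead from \<open>c\<close> (for \<open>True\<close>) or \<open>d\<close> (for \<open>False\<close>) to \<open>u n\<close>.\<close>
  define half where "half b n = (if b then xs n @ [u n] else rev (u n # ys n))" for b :: bool and n
  define P where "P e = (case e of (Inl b, Inr n) \<Rightarrow> half b n | (Inr n, Inl b) \<Rightarrow> rev (half b n) | _ \<Rightarrow> [])"
    for e :: "(bool + nat) \<times> (bool + nat)"
  define H where "H = \<lparr>pverts = f ` pverts K_2_omega \<union> (\<Union>e\<in>parcs K_2_omega. set (P e)),
    parcs = (\<Union>e\<in>parcs K_2_omega. parcs (path_graph (P e)))\<rparr>"
  have f_simps: "f (Inl True) = c" "f (Inl False) = d" "f (Inr n) = u n" for n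
    by (simp_all add: f_def)
  have P_simps: "P (Inl b, Inr n) = half b n" "P (Inr n, Inl b) = rev (half b n)" for b n
    by (simp_all add: P_def)
  have arcs: "parcs K_2_omega = range Inl \<times> range Inr \<union> range Inr \<times> range Inl"
    "pverts K_2_omega = UNIV" by (simp_all add: K_2_omega_def)
  have f_UNIV: "f ` UNIV = {c, d} \<union> range u"
    unfolding UNIV_sum UNIV_bool by (auto simp: f_simps image_Un image_image)
  have ne: "xs n \<noteq> []" "ys n \<noteq> []" for n
    using u(2)[of n] q(3,4)[of n] unfolding qn by auto
  have hd_xs: "hd (xs n) = c" and last_ys: "last (ys n) = d" for n
    using ne[of n] q(3,4)[of n] unfolding qn by auto
  have dist: "set (xs n) \<inter> set (ys n) = {}" "u n \<notin> set (xs n)" "u n \<notin> set (ys n)" for n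
    using q(1)[of n] unfolding qn is_path_def by auto
  have c_in: "c \<in> set (xs n)" and d_in: "d \<in> set (ys n)" for n
    using hd_in_set[OF ne(1)] last_in_set[OF ne(2)] hd_xs last_ys by metis+
  have half_path: "is_path (parcs G) (half b n)" for b n
    using q(1)[of n] is_path_appendD1[of "parcs G" "xs n @ [u n]" "ys n"]
      is_path_appendD2[of "parcs G" "xs n" "u n # ys n"] is_path_rev[OF sym_parcs, of "u n # ys n"]
    unfolding qn half_def by auto
  have half_set: "set (half True n) = insert (u n) (set (xs n))"
    "set (half False n) = insert (u n) (set (ys n))" for n
    by (auto simp: half_def)
  have half_sub: "set (half b n) \<subseteq> set (q n)" for b n
    by (cases b) (auto simp: half_set qn)
  have half_hd: "hd (half b n) = f (Inl b)" "last (half b n) = u n" for b n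
    using ne hd_xs[of n] last_ys[of n] by (cases b; simp add: half_def f_simps hd_rev last_rev)+
  have u_other: "u m \<notin> set (q n)" if "m \<noteq> n" for m n
    using disj[OF that] u that by blast
  have u_inj: "u m = u n \<longleftrightarrow> m = n" for m n
    using u_other u(1) by metis
  have half_meets: "set (half b n) \<inter> f ` UNIV = {f (Inl b), u n}" for b n
  proof -
    have "u m \<in> set (half b n) \<longleftrightarrow> m = n" for m
      using u_other[of m n] half_sub[of b n] half_set[of n] by (cases b; cases "m = n") auto
    moreover have "c \<in> set (half b n) \<longleftrightarrow> b" "d \<in> set (half b n) \<longleftrightarrow> \<not> b"
      using c_in[of n] d_in[of n] dist[of n] u(2)[of n] half_set[of n] by (cases b; auto)+
    ultimately show ?thesis unfolding f_UNIV by (cases b) (auto simp: f_simps)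
  qed
  have half_disj: "set (half b m) \<inter> set (half b' n) \<subseteq> f ` UNIV" if "(b, m) \<noteq> (b', n)" for b m b' n
  proof (cases "m = n")
    case True
    then have "b' = (\<not> b)" using that by auto
    then show ?thesis using True dist by (cases b) (auto simp: half_set f_UNIV)
  next
    case False
    then show ?thesis using disj[OF False] half_sub unfolding f_UNIV by blast
  qed
  have half_V: "set (half b n) \<subseteq> pverts G" for b n using half_sub q(2) by blast
  have Pe_path: "is_path (parcs G) (P e) \<and> set (P e) \<subseteq> pverts G" if "e \<in> parcs K_2_omega" for e
    using that half_path half_V unfolding arcs
    by (elim UnE SigmaE imageE) (simp_all add: P_simps is_path_rev[OF sym_parcs])
  have arcE: "\<exists>b n. {fst e, snd e} = {Inl b, Inr n} \<and> set (P e) = set (half b n)"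
    if "e \<in> parcs K_2_omega" for e
  proof -
    from that consider b n where "e = (Inl b, Inr n)" | b n where "e = (Inr n, Inl b)"
      unfolding arcs by auto
    then show ?thesis
    proof cases
      case (1 b n)
      then show ?thesis by (intro exI[of _ b] exI[of _ n]) (auto simp: P_simps)
    next
      case (2 b n)
      then show ?thesis by (intro exI[of _ b] exI[of _ n]) (auto simp: P_simps)
    qed
  qed
  have vp: "vpath (P e) (with_proj H)" if "e \<in> parcs K_2_omega" for e
  proof -
    have "is_path (parcs (path_graph (P e))) (P e)"
      using Pe_path[OF that] is_path_path_graph by blast
    then have "is_path (parcs H) (P e)"
      by (rule is_path_mono) (use that in \<open>auto simp: H_def\<close>)
    then show ?thesis using that by (auto simp: vpath_with_proj_iff H_def)
  qed
  have q_in: "set (q n) \<subseteq> pverts H" for n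
  proof -
    have "set (q n) = set (P (Inl True, Inr n)) \<union> set (P (Inl False, Inr n))"
      by (auto simp: P_simps half_set qn)
    then show ?thesis unfolding H_def arcs by auto
  qed
  have "pverts H \<subseteq> pverts G"
  proof -
    have "{c, d} \<union> range u \<subseteq> pverts G"
      using c_in[of 0] d_in[of 0] half_V[of True 0] half_V[of False 0] u(1) q(2)
      by (auto simp: half_set)
    then show ?thesis using Pe_path by (auto simp: H_def arcs(2) f_UNIV)
  qed
  moreover have "parcs H \<subseteq> parcs G" "parcs H \<subseteq> pverts H \<times> pverts H"
  proof -
    have "parcs (path_graph (P e)) \<subseteq> parcs G" "parcs (path_graph (P e)) \<subseteq> pverts H \<times> pverts H"
      if "e \<in> parcs K_2_omega" for e
    proof -
      have "pverts (path_graph (P e)) \<subseteq> pverts H"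
        using that by (auto simp: H_def path_graph_def)
      then show "parcs (path_graph (P e)) \<subseteq> parcs G"
        "parcs (path_graph (P e)) \<subseteq> pverts H \<times> pverts H"
        using path_graph_in(2,3)[of "P e"] Pe_path[OF that] by blast+
    qed
    moreover have "parcs H = (\<Union>e\<in>parcs K_2_omega. parcs (path_graph (P e)))"
      by (simp add: H_def)
    ultimately show "parcs H \<subseteq> parcs G" "parcs H \<subseteq> pverts H \<times> pverts H"
      by (simp_all add: UN_least)
  qed
  ultimately have "subgraph (with_proj H) (with_proj G)" by (intro subgraphI)
  moreover have "is_subdivision_of H K_2_omega"
    unfolding is_subdivision_of_def
  proof (intro exI[of _ f] exI[of _ P] conjI)
    show "inj_on f (pverts K_2_omega)"
    proof (rule inj_onI)
      fix x y assume "f x = f y"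
      then show "x = y" using assms(1) u(2) u_inj
        by (cases x; cases y) (auto simp: f_def split: if_splits)
    qed
    show "\<forall>(v, w)\<in>parcs K_2_omega. vpath (P (v, w)) (with_proj H) \<and> hd (P (v, w)) = f v \<and>
      last (P (v, w)) = f w \<and> P (w, v) = rev (P (v, w)) \<and> set (P (v, w)) \<inter> f ` pverts K_2_omega = {f v, f w}"
    proof (clarify, intro conjI)
      fix v w assume e: "(v, w) \<in> parcs K_2_omega"
      then show "vpath (P (v, w)) (with_proj H)" by (rule vp)
      from e show "hd (P (v, w)) = f v" "last (P (v, w)) = f w" "P (w, v) = rev (P (v, w))"
        unfolding arcs by (auto simp: P_simps half_hd hd_rev last_rev f_simps)
      from e show "set (P (v, w)) \<inter> f ` pverts K_2_omega = {f v, f w}"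
        unfolding arcs by (elim UnE SigmaE imageE) (simp_all add: P_simps half_meets f_simps insert_commute)
    qed
    show "\<forall>(v, w)\<in>parcs K_2_omega. \<forall>(x, y)\<in>parcs K_2_omega. {v, w} \<noteq> {x, y} \<longrightarrow>
      set (P (v, w)) \<inter> set (P (x, y)) \<subseteq> f ` pverts K_2_omega"
    proof (clarify del: subsetI)
      fix v w x y
      assume vw: "(v, w) \<in> parcs K_2_omega" and xy: "(x, y) \<in> parcs K_2_omega"
        and ne: "{v, w} \<noteq> {x, y}"
      obtain b m where bm: "{v, w} = {Inl b, Inr m}" "set (P (v, w)) = set (half b m)"
        using arcE[OF vw] by auto
      obtain b' n where bn: "{x, y} = {Inl b', Inr n}" "set (P (x, y)) = set (half b' n)"
        using arcE[OF xy] by auto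
      have "(b, m) \<noteq> (b', n)" using ne bm(1) bn(1) by auto
      then show "set (P (v, w)) \<inter> set (P (x, y)) \<subseteq> f ` pverts K_2_omega"
        using half_disj unfolding bm(2) bn(2) arcs by blast
    qed
  qed (simp_all add: H_def)
  ultimately show ?thesis using q_in by blast
qed

end

section \<open>Stars and combs\<close>

lemma infinite_const_or_inj:
  assumes "infinite A"
  obtains y where "infinite {x \<in> A. f x = y}" | B where "B \<subseteq> A" "infinite B" "inj_on f B"
proof (cases "finite (f ` A)")
  case True
  then show ?thesis using pigeonhole_infinite[OF assms True] that(1) by blast
next
  case False
  obtain B where "B \<subseteq> A" "inj_on f B" "f ` A = f ` B"
    using subset_image_inj[of "f ` A" f A] by auto
  then show ?thesis using that(2) False by (metis finite_imageI)
qed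

text \<open>
  A breadth-first search tree, given by its root paths. The second property says that the root path
  of every vertex \<open>x\<close> is an initial segment of each root path through \<open>x\<close>, so that the paths branch
  off from one another but never meet again.
\<close>

lemma tree_paths:
  fixes r :: "'a rel" and d :: 'a
  obtains P where
    "\<And>v. (d, v) \<in> r\<^sup>* \<Longrightarrow> is_path r (P v) \<and> hd (P v) = d \<and> last (P v) = v"
    "\<And>v p x q. (d, v) \<in> r\<^sup>* \<Longrightarrow> P v = p @ x # q \<Longrightarrow> P x = p @ [x]"
proof -
  define dist where "dist v = (LEAST n. (d, v) \<in> r ^^ n)" for v
  have dist_rel: "(d, v) \<in> r ^^ dist v" if "(d, v) \<in> r\<^sup>*" for v
    using that unfolding dist_def by (metis LeastI rtrancl_imp_relpow)
  have dist_le: "dist v \<le> n" if "(d, v) \<in> r ^^ n" for v n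
    using that unfolding dist_def by (rule Least_le)
  have "\<exists>u. (u, v) \<in> r \<and> (d, u) \<in> r\<^sup>* \<and> dist v = Suc (dist u)"
    if v: "(d, v) \<in> r\<^sup>*" "dist v \<noteq> 0" for v
  proof -
    obtain n where n: "dist v = Suc n" using v(2) not0_implies_Suc by blast
    then have "(d, v) \<in> r ^^ Suc n" using dist_rel[OF v(1)] by simp
    then obtain u where u: "(d, u) \<in> r ^^ n" "(u, v) \<in> r" by auto
    then have du: "(d, u) \<in> r\<^sup>*" by (meson relpow_imp_rtrancl)
    have "(d, v) \<in> r ^^ Suc (dist u)" using dist_rel[OF du] u(2) by auto
    then have "Suc n \<le> Suc (dist u)" using dist_le n by metis
    then show ?thesis using u du dist_le[OF u(1)] n by auto
  qed
  then obtain par where par: "\<And>v. (d, v) \<in> r\<^sup>* \<Longrightarrow> dist v \<noteq> 0 \<Longrightarrow>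
      (par v, v) \<in> r \<and> (d, par v) \<in> r\<^sup>* \<and> dist v = Suc (dist (par v))" by metis
  \<comment> \<open>The vertex in position \<open>k\<close> is the ancestor of \<open>v\<close> at distance \<open>k\<close> from the root.\<close>
  define P where "P v = map (\<lambda>k. (par ^^ (dist v - k)) v) [0..<Suc (dist v)]" for v
  have anc: "(d, (par ^^ i) v) \<in> r\<^sup>* \<and> dist ((par ^^ i) v) = dist v - i"
    if "(d, v) \<in> r\<^sup>*" "i \<le> dist v" for v i
    using that(2)
  proof (induction i)
    case (Suc i)
    then show ?case using par[of "(par ^^ i) v"] by auto
  qed (use that in auto)
  have len: "length (P v) = Suc (dist v)" for v by (simp add: P_def)
  have nth: "P v ! k = (par ^^ (dist v - k)) v" if "k \<le> dist v" for v k
    using that unfolding P_def by (subst nth_map) (auto simp del: upt_Suc)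
  have dist_nth: "dist (P v ! k) = k" if "(d, v) \<in> r\<^sup>*" "k \<le> dist v" for v k
    using anc[OF that(1), of "dist v - k"] nth[OF that(2)] that(2) by simp
  have P_ne: "P v \<noteq> []" for v using len[of v] by auto
  have d0: "v = d" if "(d, v) \<in> r\<^sup>*" "dist v = 0" for v
    using dist_rel[OF that(1)] that(2) by simp
  have path: "is_path r (P v) \<and> hd (P v) = d \<and> last (P v) = v" if v: "(d, v) \<in> r\<^sup>*" for v
  proof (intro conjI)
    have "distinct (P v)"
      unfolding distinct_conv_nth len using dist_nth[OF v] by (metis less_Suc_eq_le)
    moreover have "(P v ! k, P v ! Suc k) \<in> r" if "Suc k < length (P v)" for k
    proof -
      have k: "Suc k \<le> dist v" using that len by simp
      have eq: "dist v - k = Suc (dist v - Suc k)" using k by simp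
      have "dist ((par ^^ (dist v - Suc k)) v) = Suc k" "(d, (par ^^ (dist v - Suc k)) v) \<in> r\<^sup>*"
        using anc[OF v, of "dist v - Suc k"] k by auto
      then have "(par ((par ^^ (dist v - Suc k)) v), (par ^^ (dist v - Suc k)) v) \<in> r"
        using par by simp
      then show ?thesis using k nth[of k v] nth[of "Suc k" v] eq by simp
    qed
    ultimately show "is_path r (P v)" using P_ne by (auto simp: is_path_def successively_conv_nth)
    have "hd (P v) = (par ^^ dist v) v" using nth[of 0 v] P_ne[of v] by (simp add: hd_conv_nth)
    then show "hd (P v) = d" using anc[OF v, of "dist v"] d0 by simp
    show "last (P v) = v" using nth[of "dist v" v] P_ne[of v] len[of v] by (simp add: last_conv_nth)
  qed
  have coherent: "P x = p @ [x]" if v: "(d, v) \<in> r\<^sup>*" and eq: "P v = p @ x # q" for v p x q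
  proof -
    define k where "k = length p"
    have k: "k \<le> dist v" using len[of v] eq by (simp add: k_def)
    have x: "x = (par ^^ (dist v - k)) v" using nth[OF k] eq by (simp add: k_def)
    have dx: "dist x = k" using anc[OF v, of "dist v - k"] x k by simp
    have "P x ! i = P v ! i" if "i \<le> k" for i
    proof -
      have "P x ! i = (par ^^ (k - i)) x" using nth[of i x] that dx by simp
      also have "\<dots> = (par ^^ (k - i + (dist v - k))) v" unfolding x by (simp only: funpow_add o_apply)
      also have "k - i + (dist v - k) = dist v - i" using that k by simp
      also have "(par ^^ (dist v - i)) v = P v ! i" using nth[of i v] that k by simp
      finally show ?thesis .
    qed
    then show ?thesis using len[of x] dx eq
      by (intro nth_equalityI) (auto simp: k_def nth_append less_Suc_eq)
  qed
  show thesis using that path coherent by blast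
qed

lemma is_path_successor:
  assumes "is_path r p" "x \<in> set p" "x \<noteq> last p"
  shows "\<exists>y. (x, y) \<in> r"
proof -
  obtain u v where p: "p = u @ x # v" using assms(2) by (meson split_list)
  then have "v \<noteq> []" using assms(3) by auto
  then show ?thesis using assms(1) unfolding p
    by (auto simp: is_path_def successively_append_iff successively_Cons)
qed

text \<open>
  Root paths in a tree, one to every element of an infinite set \<open>A\<close> of leaves, contain a star with
  leaves in \<open>A\<close> or a comb with teeth in \<open>A\<close>. Call a common initial segment of infinitely many of the
  paths heavy. If a heavy segment has no heavy extension, infinitely many of its paths leave its last
  vertex \<open>c\<close> along different edges and form a star with centre \<open>c\<close>. Otherwise heavy segments can be
  extended forever, which traces a ray \<open>L\<close>; each path of the family leaves \<open>L\<close> at some level \<open>M t\<close>,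
  these levels are unbounded, and the parts of paths behind different levels are disjoint.
\<close>

lemma star_comb:
  fixes P :: "'a \<Rightarrow> 'a list"
  assumes A: "infinite A"
    and P: "\<And>t. t \<in> A \<Longrightarrow> is_path E (P t) \<and> hd (P t) = d \<and> last (P t) = t \<and> set (P t) \<inter> A \<subseteq> {t}"
    and coh: "\<And>s t p p' x q q'. s \<in> A \<Longrightarrow> t \<in> A \<Longrightarrow> P s = p @ x # q \<Longrightarrow> P t = p' @ x # q' \<Longrightarrow> p = p'"
  obtains (star) c F where "infinite F" "c \<notin> A"
      "\<And>p. p \<in> F \<Longrightarrow> is_path E p \<and> hd p = c \<and> last p \<in> A \<and> set p \<subseteq> (\<Union>t\<in>A. set (P t)) \<and> set p \<inter> A \<subseteq> {last p}"
      "\<And>p q. p \<in> F \<Longrightarrow> q \<in> F \<Longrightarrow> p \<noteq> q \<Longrightarrow> set p \<inter> set q \<subseteq> {c}"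
    | (comb) L F where "infinite F" "ray E L" "range L \<subseteq> (\<Union>t\<in>A. set (P t)) - A"
      "\<And>p. p \<in> F \<Longrightarrow> is_path E p \<and> set p \<inter> range L = {hd p} \<and> last p \<in> A \<and>
         set p \<subseteq> (\<Union>t\<in>A. set (P t)) \<and> set p \<inter> A \<subseteq> {last p}"
      "\<And>p q. p \<in> F \<Longrightarrow> q \<in> F \<Longrightarrow> p \<noteq> q \<Longrightarrow> set p \<inter> set q = {}"
proof -
  define heavy where "heavy q \<longleftrightarrow> infinite {t \<in> A. prefix q (P t)}" for q
  have heavy_ex: "\<exists>t\<in>A. prefix q (P t)" if "heavy q" for q
    using that not_finite_existsD unfolding heavy_def by fastforce
  have heavy_notin: "last q \<notin> A" if q: "heavy q" "q \<noteq> []" for q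
  proof
    assume "last q \<in> A"
    have "t = last q" if "t \<in> A" "prefix q (P t)" for t
    proof -
      have "last q \<in> set (P t)" using set_mono_prefix[OF that(2)] last_in_set[OF q(2)] by blast
      then show ?thesis using P[OF that(1)] \<open>last q \<in> A\<close> by blast
    qed
    then have "{t \<in> A. prefix q (P t)} \<subseteq> {last q}" by blast
    then show False using q(1) unfolding heavy_def by (meson finite.emptyI finite_insert finite_subset)
  qed
  have Pne: "P t \<noteq> []" if "t \<in> A" for t using P[OF that] is_path_neq_Nil by blast
  have "prefix [d] (P t)" if "t \<in> A" for t
    using P[OF that] Pne[OF that] by (cases "P t") auto
  then have "{t \<in> A. prefix [d] (P t)} = A" by auto
  then have heavy_d: "heavy [d]" using A by (simp add: heavy_def)
  show thesis
  proof (cases "\<exists>q. q \<noteq> [] \<and> heavy q \<and> (\<forall>x. \<not> heavy (q @ [x]))")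
    case True
    then obtain q where q: "q \<noteq> []" "heavy q" "\<And>x. \<not> heavy (q @ [x])" by auto
    define c where "c = last q"
    have cA: "c \<notin> A" using heavy_notin q by (simp add: c_def)
    define B where "B = {t \<in> A. prefix q (P t)}"
    define rest where "rest t = drop (length q) (P t)" for t
    have Pt: "P t = q @ rest t" if "t \<in> B" for t
      using that by (auto simp: B_def rest_def prefix_def)
    have rest_ne: "rest t \<noteq> []" if "t \<in> B" for t
    proof
      assume "rest t = []"
      then have "last (P t) = c" using Pt[OF that] by (simp add: c_def)
      then show False using P[of t] that cA by (auto simp: B_def)
    qed
    have fibre: "finite {t \<in> B. hd (rest t) = x}" for x
    proof (rule finite_subset)
      show "{t \<in> B. hd (rest t) = x} \<subseteq> {t \<in> A. prefix (q @ [x]) (P t)}"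
      proof clarify
        fix t assume t: "t \<in> B"
        have "P t = (q @ [hd (rest t)]) @ tl (rest t)"
          using Pt[OF t] rest_ne[OF t] by simp
        then show "t \<in> A \<and> prefix (q @ [hd (rest t)]) (P t)"
          using t by (auto simp: B_def prefix_def)
      qed
      show "finite {t \<in> A. prefix (q @ [x]) (P t)}" using q(3)[of x] by (simp add: heavy_def)
    qed
    have "infinite B" using q(2) by (simp add: B_def heavy_def)
    then obtain B' where B': "B' \<subseteq> B" "infinite B'" "inj_on (\<lambda>t. hd (rest t)) B'"
      by (rule infinite_const_or_inj[of B "\<lambda>t. hd (rest t)"]) (use fibre in auto)
    define F where "F = (\<lambda>t. c # rest t) ` B'"
    have path: "is_path E (c # rest t)" if "t \<in> B" for t
    proof -
      have "P t = butlast q @ (c # rest t)" using Pt[OF that] q(1) by (simp add: c_def)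
      then show ?thesis using P[of t] that is_path_appendD2[of E "butlast q" "c # rest t"]
        by (auto simp: B_def)
    qed
    have lst: "last (c # rest t) = t" if "t \<in> B" for t
      using P[of t] that Pt[OF that] rest_ne[OF that] by (auto simp: B_def)
    have sub: "set (c # rest t) \<subseteq> set (P t)" if "t \<in> B" for t
      using Pt[OF that] last_in_set[OF q(1)] by (auto simp: c_def)
    show thesis
    proof (rule star[of F c])
      have "inj_on (\<lambda>t. c # rest t) B'" using B'(3) by (auto simp: inj_on_def)
      then show "infinite F" using B'(2) by (simp add: F_def finite_image_iff)
      show "c \<notin> A" by (rule cA)
    next
      fix p assume "p \<in> F"
      then obtain t where t: "t \<in> B'" "p = c # rest t" by (auto simp: F_def)
      then have tB: "t \<in> B" "t \<in> A" using B'(1) by (auto simp: B_def)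
      show "is_path E p \<and> hd p = c \<and> last p \<in> A \<and> set p \<subseteq> (\<Union>t\<in>A. set (P t)) \<and> set p \<inter> A \<subseteq> {last p}"
        using path[OF tB(1)] lst[OF tB(1)] sub[OF tB(1)] P[OF tB(2)] tB(2)
        unfolding t(2) by auto
    next
      fix p p' assume "p \<in> F" "p' \<in> F" "p \<noteq> p'"
      then obtain s t where st: "s \<in> B'" "t \<in> B'" "p = c # rest s" "p' = c # rest t" "s \<noteq> t"
        by (auto simp: F_def)
      have "set (rest s) \<inter> set (rest t) = {}"
      proof (rule ccontr)
        assume "set (rest s) \<inter> set (rest t) \<noteq> {}"
        then obtain x where "x \<in> set (rest s)" "x \<in> set (rest t)" by blast
        then obtain u v u' v' where uv: "rest s = u @ x # v" "rest t = u' @ x # v'"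
          by (meson split_list)
        have B: "s \<in> B" "t \<in> B" using st B'(1) by auto
        have "q @ u = q @ u'"
          using coh[of s t "q @ u" x v "q @ u'" v'] Pt[OF B(1)] Pt[OF B(2)] uv B
          by (auto simp: B_def)
        then have "hd (rest s) = hd (rest t)" using uv by (cases u) auto
        then show False using st B'(3) by (auto simp: inj_on_def)
      qed
      then show "set p \<inter> set p' \<subseteq> {c}" using st by auto
    qed
  next
    case False
    then obtain nx where nx: "\<And>q. q \<noteq> [] \<Longrightarrow> heavy q \<Longrightarrow> heavy (q @ [nx q])" by metis
    define Q where "Q n = ((\<lambda>q. q @ [nx q]) ^^ n) [d]" for n
    have Q_Suc: "Q (Suc n) = Q n @ [nx (Q n)]" for n by (simp add: Q_def)
    have Q_ne: "Q n \<noteq> []" for n by (induction n) (simp_all add: Q_def)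
    have Q_heavy: "heavy (Q n)" for n
      by (induction n) (simp add: Q_def heavy_d, simp add: Q_Suc nx Q_ne)
    define L where "L n = last (Q n)" for n
    have Q_L: "Q n = map L [0..<n] @ [L n]" for n
      by (induction n) (simp_all add: Q_Suc L_def, simp add: Q_def)
    have L_path: "is_path E (map L [0..<n] @ [L n])" for n
    proof -
      obtain t where t: "t \<in> A" "prefix (Q n) (P t)" using heavy_ex[OF Q_heavy] by blast
      then obtain z where "P t = Q n @ z" by (auto simp: prefix_def)
      then show ?thesis using P[OF t(1)] is_path_appendD1[of E "Q n" z] Q_ne Q_L[of n] by auto
    qed
    have L_notin: "L n \<notin> A" for n using heavy_notin[OF Q_heavy Q_ne] by (simp add: L_def)
    have "ray E L"
      unfolding ray_def
    proof
      show "inj L"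
      proof (rule linorder_injI)
        fix m n :: nat assume "m < n"
        then have "L m \<in> set (map L [0..<n])" by auto
        moreover have "L n \<notin> set (map L [0..<n])" using L_path[of n] by (simp add: is_path_def)
        ultimately show "L m \<noteq> L n" by metis
      qed
      show "\<forall>i. (L i, L (Suc i)) \<in> E"
      proof
        fix i show "(L i, L (Suc i)) \<in> E"
          using L_path[of "Suc i"] by (simp add: is_path_def successively_append_iff)
      qed
    qed
    define M where "M t = Max {m. prefix (Q m) (P t)}" for t
    have M_fin: "finite {m. prefix (Q m) (P t)}" for t
    proof (rule finite_subset)
      show "{m. prefix (Q m) (P t)} \<subseteq> {..length (P t)}"
        by (auto simp: Q_L dest!: prefix_length_le)
    qed simp
    have M_ge: "m \<le> M t" if "prefix (Q m) (P t)" for m t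
      unfolding M_def using M_fin that by (intro Max_ge) auto
    have M_in: "prefix (Q (M t)) (P t)" if "t \<in> A" for t
    proof -
      have "prefix (Q 0) (P t)" using P[OF that] Pne[OF that] by (cases "P t") (auto simp: Q_def)
      then have "M t \<in> {m. prefix (Q m) (P t)}"
        unfolding M_def using M_fin by (intro Max_in) auto
      then show ?thesis by simp
    qed
    define D where "D t = drop (M t) (P t)" for t
    have PD: "P t = map L [0..<M t] @ D t" and D_hd: "\<exists>z. D t = L (M t) # z" if t: "t \<in> A" for t
    proof -
      obtain z where "P t = Q (M t) @ z" using M_in[OF t] by (auto simp: prefix_def)
      then have eq: "P t = map L [0..<M t] @ (L (M t) # z)" by (simp add: Q_L)
      then have "D t = L (M t) # z" by (simp add: D_def)
      then show "P t = map L [0..<M t] @ D t" "\<exists>z. D t = L (M t) # z" using eq by auto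
    qed
    have "infinite (M ` A)"
    proof
      assume fin: "finite (M ` A)"
      define N where "N = Suc (Max (M ` A))"
      obtain t where t: "t \<in> A" "prefix (Q N) (P t)" using heavy_ex[OF Q_heavy] by blast
      then have "N \<le> M t" by (intro M_ge)
      moreover have "M t \<le> Max (M ` A)" using fin t by auto
      ultimately show False by (simp add: N_def)
    qed
    then obtain B where B: "B \<subseteq> A" "infinite B" "inj_on M B"
      using subset_image_inj[of "M ` A" M A] by (metis finite_imageI order_refl)
    define F where "F = D ` B"
    have D_path: "is_path E (D t)" "last (D t) = t" "set (D t) \<subseteq> set (P t)" if t: "t \<in> A" for t
    proof -
      have ne: "D t \<noteq> []" using D_hd[OF t] by auto
      show "is_path E (D t)"
        using P[OF t] PD[OF t] is_path_appendD2[of E "map L [0..<M t]" "D t"] ne by auto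
      show "last (D t) = t" using P[OF t] PD[OF t] ne by (metis last_appendR)
      show "set (D t) \<subseteq> set (P t)" by (simp add: D_def set_drop_subset)
    qed
    \<comment> \<open>A second vertex of the ray on the branch would make a longer piece of the ray a prefix.\<close>
    have D_L: "set (D t) \<inter> range L = {hd (D t)}" if t: "t \<in> A" for t
    proof -
      obtain z where z: "D t = L (M t) # z" using D_hd[OF t] by blast
      have "L i \<notin> set z" for i
      proof
        assume "L i \<in> set z"
        then obtain u v where uv: "z = u @ L i # v" by (meson split_list)
        obtain s y where s: "s \<in> A" "P s = Q i @ y"
          using heavy_ex[OF Q_heavy[of i]] by (auto simp: prefix_def)
        have Ps: "P s = map L [0..<i] @ L i # y" using s(2) by (simp add: Q_L)
        have Pt: "P t = (map L [0..<M t] @ L (M t) # u) @ L i # v" using PD[OF t] z uv by simp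
        have eq: "map L [0..<i] = map L [0..<M t] @ L (M t) # u"
          using coh[OF s(1) t Ps Pt] .
        then have "P t = Q i @ v" using Pt by (simp add: Q_L)
        then have "i \<le> M t" by (intro M_ge) (simp add: prefix_def)
        moreover have "i = M t + Suc (length u)" using arg_cong[OF eq, of length] by simp
        ultimately show False by simp
      qed
      then show ?thesis using z by auto
    qed
    have D_disj: "set (D s) \<inter> set (D t) = {}" if st: "s \<in> A" "t \<in> A" "M s < M t" for s t
    proof (rule ccontr)
      assume "set (D s) \<inter> set (D t) \<noteq> {}"
      then obtain x where "x \<in> set (D s)" "x \<in> set (D t)" by blast
      then obtain u v u' v' where uv: "D s = u @ x # v" "D t = u' @ x # v'"
        by (meson split_list)
      have Ps: "P s = (map L [0..<M s] @ u) @ x # v" and Pt: "P t = (map L [0..<M t] @ u') @ x # v'"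
        using PD[OF st(1)] PD[OF st(2)] uv by auto
      have "map L [0..<M s] @ u = map L [0..<M t] @ u'" using coh[OF st(1,2) Ps Pt] .
      then have Ps': "P s = map L [0..<M t] @ (u' @ x # v)" using Ps by simp
      obtain z where "D t = L (M t) # z" using D_hd[OF st(2)] by blast
      then obtain w where "u' @ x # v = L (M t) # w" using uv(2) by (cases u') auto
      then have "P s = Q (M t) @ w" using Ps' by (simp add: Q_L)
      then have "M t \<le> M s" by (intro M_ge) (simp add: prefix_def)
      then show False using st(3) by simp
    qed
    show thesis
    proof (rule comb[of F L])
      have "inj_on D B" using D_path(2) B(1) by (metis inj_on_def subsetD)
      then show "infinite F" using B(2) by (simp add: F_def finite_image_iff)
      show "ray E L" by fact
      have "L n \<in> (\<Union>t\<in>A. set (P t))" for n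
      proof -
        obtain t where t: "t \<in> A" "prefix (Q n) (P t)" using heavy_ex[OF Q_heavy] by blast
        then show ?thesis using set_mono_prefix[OF t(2)] by (auto simp: Q_L)
      qed
      then show "range L \<subseteq> (\<Union>t\<in>A. set (P t)) - A" using L_notin by blast
    next
      fix p assume "p \<in> F"
      then obtain t where t: "t \<in> A" "p = D t" using B(1) by (auto simp: F_def)
      show "is_path E p \<and> set p \<inter> range L = {hd p} \<and> last p \<in> A \<and>
         set p \<subseteq> (\<Union>t\<in>A. set (P t)) \<and> set p \<inter> A \<subseteq> {last p}"
        unfolding t(2) D_path(2)[OF t(1)]
      proof (intro conjI)
        show "set (D t) \<subseteq> (\<Union>t\<in>A. set (P t))" using D_path(3)[OF t(1)] t(1) by blast
        show "set (D t) \<inter> A \<subseteq> {t}" using D_path(3)[OF t(1)] P[OF t(1)] by blast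
      qed (use D_path(1)[OF t(1)] D_L[OF t(1)] t(1) in auto)
    next
      fix p q assume "p \<in> F" "q \<in> F" "p \<noteq> q"
      then obtain s t where st: "s \<in> B" "t \<in> B" "p = D s" "q = D t" "s \<noteq> t" by (auto simp: F_def)
      then have "M s \<noteq> M t" using B(3) by (auto simp: inj_on_def)
      then show "set p \<inter> set q = {}"
        using D_disj[of s t] D_disj[of t s] st B(1) by (cases "M s < M t") auto
    qed
  qed
qed

section \<open>A ray in a 2-connected graph\<close>

context two_connected_graph
begin

text \<open>
  In the search tree from \<open>d = R j\<close> the other vertices of \<open>R\<close> are leaves, as \<open>r\<close> has no arc leaving
  them. Infinitely many vertices of the tail \<open>R'\<close> of \<open>R\<close> behind \<open>d\<close> are reached. A star in the tree
  with leaves on \<open>R'\<close> gives a fan, and a comb with teeth on \<open>R'\<close> gives a ladder.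
\<close>

lemma cofinal_ears_ladder_or_fan:
  assumes R: "ray (parcs G) R"
    and ears: "\<And>N. \<exists>k\<ge>N. \<exists>p. is_path (parcs G) p \<and> hd p = R j \<and> last p = R k \<and>
      set p \<inter> range R \<subseteq> {R j, R k}"
  shows "\<exists>H. subgraph (with_proj H) (with_proj G) \<and> (is_ladder H \<or> is_fan H) \<and> R ` {j<..} \<subseteq> pverts H"
proof -
  note R_eq = ray_eq_iff[OF R]
  define d where "d = R j"
  define r where "r = {(x, y) \<in> parcs G. x \<in> range R \<longrightarrow> x = d}"
  define A where "A = {R k |k. j < k \<and> (d, R k) \<in> r\<^sup>*}"
  define R' where "R' i = R (i + Suc j)" for i
  have R': "ray (parcs G) R'" unfolding R'_def by (rule ray_tail[OF R])
  have range_R': "range R' = R ` {j<..}"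
  proof -
    have "{j<..} = (\<lambda>i. i + Suc j) ` UNIV"
    proof (intro equalityI subsetI)
      fix k assume "k \<in> {j<..}"
      then have "k = (k - Suc j) + Suc j" by simp
      then show "k \<in> (\<lambda>i. i + Suc j) ` UNIV" by (rule image_eqI) simp
    qed auto
    then show ?thesis by (simp add: R'_def image_image)
  qed
  have dV: "d \<in> pverts G" using ray_in_pverts[OF R] by (auto simp: d_def)
  obtain P where P: "\<And>v. (d, v) \<in> r\<^sup>* \<Longrightarrow> is_path r (P v) \<and> hd (P v) = d \<and> last (P v) = v"
    and coh: "\<And>v p x q. (d, v) \<in> r\<^sup>* \<Longrightarrow> P v = p @ x # q \<Longrightarrow> P x = p @ [x]"
    using tree_paths[of d r] by blast
  have A_reach: "(d, t) \<in> r\<^sup>*" if "t \<in> A" for t using that by (auto simp: A_def)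
  have A_R: "A \<subseteq> range R'" by (auto simp: A_def range_R')
  have dA: "d \<notin> A" by (auto simp: A_def d_def R_eq)
  have P_path: "is_path (parcs G) (P t)" if "t \<in> A" for t
    using P[OF A_reach[OF that]] by (auto simp: r_def elim!: is_path_mono)
  have P_V: "set (P t) \<subseteq> pverts G" if "t \<in> A" for t
    using is_path_V[OF P_path[OF that]] P[OF A_reach[OF that]] dV by auto
  have P_R: "set (P t) \<inter> range R' \<subseteq> {t}" if "t \<in> A" for t
  proof
    fix x assume x: "x \<in> set (P t) \<inter> range R'"
    then have "x \<in> range R" "x \<noteq> d" by (auto simp: R'_def d_def R_eq)
    then have "\<nexists>y. (x, y) \<in> r" by (auto simp: r_def)
    then show "x \<in> {t}" using is_path_successor[of r "P t" x] P[OF A_reach[OF that]] x by auto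
  qed
  have inf_A: "infinite A"
  proof
    assume "finite A"
    moreover have "A = R ` {k. j < k \<and> (d, R k) \<in> r\<^sup>*}" by (auto simp: A_def)
    moreover have "inj R" using R by (simp add: ray_def)
    ultimately have "finite {k. j < k \<and> (d, R k) \<in> r\<^sup>*}"
      by (simp add: finite_image_iff inj_on_subset[OF _ subset_UNIV])
    then obtain N where N: "\<And>k. j < k \<Longrightarrow> (d, R k) \<in> r\<^sup>* \<Longrightarrow> k < N"
      by (metis (mono_tags, lifting) finite_nat_set_iff_bounded mem_Collect_eq)
    obtain k p where kp: "max N (Suc j) \<le> k" "is_path (parcs G) p" "hd p = R j" "last p = R k"
      "set p \<inter> range R \<subseteq> {R j, R k}"
      using ears[of "max N (Suc j)"] by blast
    have "is_path r p"
    proof -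
      have dp: "distinct p" "p \<noteq> []" using kp(2) by (auto simp: is_path_def)
      have "(p ! i, p ! Suc i) \<in> r" if i: "Suc i < length p" for i
      proof -
        have "p ! i \<noteq> last p" using dp i by (simp add: last_conv_nth nth_eq_iff_index_eq)
        moreover have "p ! i \<in> set p" using i by simp
        ultimately have "p ! i \<in> range R \<longrightarrow> p ! i = d" using kp(4,5) by (auto simp: d_def)
        moreover have "(p ! i, p ! Suc i) \<in> parcs G"
          using kp(2) i by (auto simp: is_path_def successively_conv_nth)
        ultimately show ?thesis by (simp add: r_def)
      qed
      then show ?thesis using dp by (auto simp: is_path_def successively_conv_nth)
    qed
    then have "(hd p, last p) \<in> avoid r {}"
      using last_in_set[of p] is_path_neq_Nil[of r p] by (intro is_path_avoid) auto
    then have "(d, R k) \<in> r\<^sup>*" using kp(3,4) by (simp add: d_def)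
    then show False using N[of k] kp(1) by auto
  qed
  have P_A: "is_path (parcs G) (P t) \<and> hd (P t) = d \<and> last (P t) = t \<and> set (P t) \<inter> A \<subseteq> {t}"
    if "t \<in> A" for t
    using P_path[OF that] P[OF A_reach[OF that]] P_R[OF that] A_R by auto
  have coh_A: "p = p'" if "s \<in> A" "t \<in> A" "P s = p @ x # q" "P t = p' @ x # q'" for s t p p' x q q'
    using coh[OF A_reach[OF that(1)] that(3)] coh[OF A_reach[OF that(2)] that(4)] by simp
  show ?thesis
  proof (rule star_comb[of A "parcs G" P d], goal_cases)
    case 1
    show ?case by (rule inf_A)
  next
    case 2
    then show ?case by (rule P_A)
  next
    case 3
    then show ?case by (rule coh_A)
  next
    case star: (4 c F)
    have UP: "(\<Union>t\<in>A. set (P t)) \<inter> range R' \<subseteq> A" using P_R by blast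
    have F: "is_path (parcs G) p \<and> set p \<subseteq> pverts G \<and> hd p = c \<and> set p \<inter> range R' = {last p}"
      if "p \<in> F" for p
    proof -
      have p: "is_path (parcs G) p" "hd p = c" "last p \<in> A"
        "set p \<subseteq> (\<Union>t\<in>A. set (P t))" "set p \<inter> A \<subseteq> {last p}"
        using star(3)[OF that] by blast+
      have "last p \<in> set p" using is_path_neq_Nil[OF p(1)] by (rule last_in_set)
      moreover have "last p \<in> range R'" using p(3) A_R by (rule rev_subsetD)
      moreover have "set p \<inter> range R' \<subseteq> {last p}" using p(4,5) UP by blast
      ultimately have "set p \<inter> range R' = {last p}" by blast
      moreover have "set p \<subseteq> pverts G" using p(4) P_V by blast
      ultimately show ?thesis using p(1,2) by (intro conjI)
    qed
    obtain p where "p \<in> F" using star(1) by (metis finite.emptyI ex_in_conv)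
    then have p: "is_path (parcs G) p" "hd p = c" "set p \<subseteq> (\<Union>t\<in>A. set (P t))"
      using star(3) by auto
    then have "c \<in> (\<Union>t\<in>A. set (P t))"
      using hd_in_set[OF is_path_neq_Nil[OF p(1)]] by auto
    then have "c \<notin> range R'" using UP star(2) by blast
    from fanI[OF R' this star(1) F star(4)] show ?thesis using range_R' by auto
  next
    case comb: (5 L F)
    have UP: "(\<Union>t\<in>A. set (P t)) \<inter> range R' \<subseteq> A" using P_R by blast
    have F: "is_path (parcs G) p \<and> set p \<subseteq> pverts G \<and> set p \<inter> range L = {hd p} \<and>
        set p \<inter> range R' = {last p}"
      if "p \<in> F" for p
    proof -
      have p: "is_path (parcs G) p" "set p \<inter> range L = {hd p}" "last p \<in> A"
        "set p \<subseteq> (\<Union>t\<in>A. set (P t))" "set p \<inter> A \<subseteq> {last p}"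
        using comb(4)[OF that] by blast+
      have "last p \<in> set p" using is_path_neq_Nil[OF p(1)] by (rule last_in_set)
      moreover have "last p \<in> range R'" using p(3) A_R by (rule rev_subsetD)
      moreover have "set p \<inter> range R' \<subseteq> {last p}" using p(4,5) UP by blast
      ultimately have "set p \<inter> range R' = {last p}" by blast
      moreover have "set p \<subseteq> pverts G" using p(4) P_V by blast
      ultimately show ?thesis using p(1,2) by (intro conjI)
    qed
    have "range L \<inter> range R' = {}" using comb(3) UP by blast
    from ladderI[OF comb(2) R' this comb(1) F comb(5)] show ?thesis using range_R' by auto
  qed
qed

end

context two_connected_graph
begin

text \<open>
  The ears are interleaved along \<open>R\<close> in the order \<open>a 0 < a 1 < b 0 \<le> a 2 < b 1 \<le> a 3 < b 2 \<le> \<dots>\<close>. The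
  ears with even index, linked by the segments of \<open>R\<close> from \<open>b n\<close> to \<open>a (n + 2)\<close>, form one ray, and
  those with odd index form another. The segments from \<open>a (n + 1)\<close> to \<open>b n\<close>, which make up the rest of
  a tail of \<open>R\<close>, join these two rays. They are not disjoint if \<open>b n = a (n + 2)\<close>, but those with
  \<open>n\<close> of the same parity are. This gives two ladders, which together cover a tail of \<open>R\<close>, so that one
  of them contains infinitely many vertices of \<open>U\<close>.
\<close>

lemma zigzag_ladder:
  assumes R: "ray (parcs G) R" and U: "infinite (U \<inter> range R)"
    and J: "\<And>n. is_path (parcs G) (J n)" "\<And>n. hd (J n) = R (a n)" "\<And>n. last (J n) = R (b n)"
      "\<And>n. set (J n) \<inter> range R \<subseteq> {R (a n), R (b n)}"
    and disj: "\<And>m n. m \<noteq> n \<Longrightarrow> set (J m) \<inter> set (J n) \<subseteq> range R"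
    and ab: "\<And>n. a n < a (Suc n)" "\<And>n. a (Suc n) < b n" "\<And>n. b n \<le> a (Suc (Suc n))"
  shows "\<exists>H. subgraph (with_proj H) (with_proj G) \<and> is_ladder H \<and> infinite (pverts H \<inter> U)"
proof -
  note R_eq = ray_eq_iff[OF R]
  have a_less: "a m < a n" if "m < n" for m n
    using lift_Suc_mono_less[of a m n] ab(1) that by simp
  have a_le: "a m \<le> a n" if "m \<le> n" for m n
    using a_less[of m n] that by (cases "m = n") auto
  have b_Suc: "b n < b (Suc n)" for n using ab(2)[of "Suc n"] ab(3)[of n] by simp
  have b_less: "b m < b n" if "m < n" for m n
    using lift_Suc_mono_less[of b m n] b_Suc that by simp
  have ba: "b m \<le> a n" if "Suc m < n" for m n
    using ab(3)[of m] a_le[of "Suc (Suc m)" n] that by simp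
  have ab_less: "a n < b n" for n using ab(1,2)[of n] by simp
  have "\<exists>r. ray (parcs G) r \<and>
      range r = (\<Union>n. set (J (2 * n + e)) \<union> R ` {b (2 * n + e)..a (2 * Suc n + e)})" for e
    using R J disj ab_less ab(3)
    by (intro switch_ray[where a = "\<lambda>n. a (2 * n + e)" and b = "\<lambda>n. b (2 * n + e)"]) auto
  then obtain S where S: "\<And>e. ray (parcs G) (S e)"
    "\<And>e. range (S e) = (\<Union>n. set (J (2 * n + e)) \<union> R ` {b (2 * n + e)..a (2 * Suc n + e)})"
    by metis
  \<comment> \<open>\<open>inS i m\<close> says that \<open>R i\<close> lies on the \<open>m\<close>-th ear or on the segment of \<open>R\<close> that follows it.\<close>
  define inS where "inS i m \<longleftrightarrow> i = a m \<or> (b m \<le> i \<and> i \<le> a (m + 2))" for i m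
  have S_R: "R i \<in> range (S e) \<longleftrightarrow> (\<exists>n. inS i (2 * n + e))" for i e
  proof
    assume "R i \<in> range (S e)"
    then obtain n where "R i \<in> set (J (2 * n + e)) \<or> R i \<in> R ` {b (2 * n + e)..a (2 * Suc n + e)}"
      unfolding S(2) by auto
    then have "inS i (2 * n + e)"
    proof
      assume "R i \<in> set (J (2 * n + e))"
      then have "R i \<in> {R (a (2 * n + e)), R (b (2 * n + e))}" using J(4) by blast
      then show ?thesis using ab(3)[of "2 * n + e"] by (auto simp: inS_def R_eq)
    qed (auto simp: inS_def R_eq)
    then show "\<exists>n. inS i (2 * n + e)" ..
  next
    assume "\<exists>n. inS i (2 * n + e)"
    then obtain n where n: "inS i (2 * n + e)" by blast
    have "R (a (2 * n + e)) \<in> set (J (2 * n + e))"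
      using J(1,2)[of "2 * n + e"] is_path_neq_Nil hd_in_set by metis
    then have "R i \<in> set (J (2 * n + e)) \<union> R ` {b (2 * n + e)..a (2 * Suc n + e)}"
      using n by (auto simp: inS_def)
    then show "R i \<in> range (S e)" unfolding S(2) by blast
  qed
  have inS_disj: "even (m + n)" if i: "inS i m" "inS i n" for i m n
  proof -
    have *: "even (m + n)" if "m < n" "inS i m" "inS i n" for m n
    proof (rule ccontr)
      assume odd: "odd (m + n)"
      have "i \<le> a (m + 2)" using that(2) a_le[of m "m + 2"] by (auto simp: inS_def)
      moreover have "a (m + 2) < b n"
        using a_le[of "m + 2" "Suc n"] ab(2)[of n] that(1) by simp
      ultimately have i: "i = a n" using that(3) by (auto simp: inS_def)
      then have "b m \<le> a n \<and> a n \<le> a (m + 2)" using that(2) a_less[OF that(1)] by (auto simp: inS_def)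
      moreover have "n \<noteq> Suc m" using calculation ab(2)[of m] by auto
      moreover have "n \<noteq> m + 2" using odd by auto
      ultimately show False using that(1) a_less[of "m + 2" n] by simp
    qed
    show ?thesis using *[of m n] *[of n m] i by (cases m n rule: linorder_cases) (auto simp: add.commute)
  qed
  have S_disj: "range (S e) \<inter> range (S f) = {}" if ef: "odd (e + f)" for e f
  proof (rule ccontr)
    assume "range (S e) \<inter> range (S f) \<noteq> {}"
    then obtain x where x: "x \<in> range (S e)" "x \<in> range (S f)" by blast
    show False
    proof (cases "x \<in> range R")
      case True
      then obtain i where "x = R i" by blast
      then obtain m n where "inS i (2 * m + e)" "inS i (2 * n + f)" using x S_R by blast
      then have "even (2 * m + e + (2 * n + f))" by (rule inS_disj)
      then show False using ef by simp
    next
      case False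
      then obtain m n where "x \<in> set (J (2 * m + e))" "x \<in> set (J (2 * n + f))"
        using x unfolding S(2) by blast
      moreover have "2 * m + e \<noteq> 2 * n + f" using ef by presburger
      ultimately show False using disj False by blast
    qed
  qed
  have inS_rung: "(i = a (Suc n) \<and> odd (m + n)) \<or> (i = b n \<and> even (m + n))"
    if i: "a (Suc n) \<le> i" "i \<le> b n" "inS i m" for i m n
    using i(3) unfolding inS_def
  proof
    assume im: "i = a m"
    have "Suc n \<le> m" using i(1) im a_less[of m "Suc n"] by (meson not_le)
    moreover have "m \<le> n + 2"
      using i(2) im ab(3)[of n] a_less[of "n + 2" m] by (intro leI) auto
    ultimately consider "m = Suc n" | "m = n + 2" by linarith
    then show ?thesis
    proof cases
      case 2
      then have "i = b n" using im i(2) ab(3)[of n] by simp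
      then show ?thesis using 2 by simp
    qed (use im in simp)
  next
    assume im: "b m \<le> i \<and> i \<le> a (m + 2)"
    show ?thesis
    proof (cases m n rule: linorder_cases)
      case less
      then have "a (m + 2) \<le> a (Suc n)" by (intro a_le) simp
      then have "i = a (Suc n)" "a (m + 2) = a (Suc n)" using im i by auto
      moreover from this have "m + 2 = Suc n"
        using a_less[of "m + 2" "Suc n"] less by (cases "m + 2 = Suc n") auto
      then have "odd (m + n)" by presburger
      ultimately show ?thesis by blast
    next
      case equal
      then show ?thesis using im i by auto
    next
      case greater
      then show ?thesis using b_less[of n m] im i by auto
    qed
  qed
  define rung where "rung n = rev (map R [a (Suc n)..<Suc (b n)])" for n
  have rung_set: "set (rung n) = R ` {a (Suc n)..b n}" for n
    by (simp add: rung_def atLeastLessThanSuc_atLeastAtMost del: upt_Suc)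
  have rung_hd: "hd (rung n) = R (b n)" and rung_last: "last (rung n) = R (a (Suc n))" for n
    using ab(2)[of n] by (simp_all add: rung_def hd_rev last_rev hd_map upt_conv_Cons)
  have rung_path: "is_path (parcs G) (rung n)" for n
    using is_path_segment[OF R, of "a (Suc n)" "Suc (b n)"] ab(2)[of n]
    unfolding rung_def by (simp add: is_path_rev[OF sym_parcs] del: upt_Suc)
  define W where "W e = range (S e) \<union> range (S (1 - e)) \<union> (\<Union>n. set (rung (2 * n + e)))" for e
  have ladder: "\<exists>H. subgraph (with_proj H) (with_proj G) \<and> is_ladder H \<and> W e \<subseteq> pverts H"
    if e: "e \<in> {0, 1}" for e
  proof -
    define F where "F = range (\<lambda>n. rung (2 * n + e))"
    have odd_e: "odd (e + (1 - e))" using e by auto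
    have "inj (\<lambda>n. rung (2 * n + e))"
    proof (rule injI)
      fix m n assume "rung (2 * m + e) = rung (2 * n + e)"
      then have "b (2 * m + e) = b (2 * n + e)" using rung_hd R_eq by metis
      then show "m = n" using b_less[of "2 * m + e" "2 * n + e"] b_less[of "2 * n + e" "2 * m + e"]
        by (cases m n rule: linorder_cases) auto
    qed
    then have "infinite F" unfolding F_def by (rule range_inj_infinite)
    moreover have "is_path (parcs G) p \<and> set p \<subseteq> pverts G \<and>
        set p \<inter> range (S e) = {hd p} \<and> set p \<inter> range (S (1 - e)) = {last p}" if pF: "p \<in> F" for p
    proof -
      obtain k where p: "p = rung (2 * k + e)" using pF by (auto simp: F_def)
      define n where "n = 2 * k + e"
      have en: "even (n + e)" by (simp add: n_def)
      have p: "p = rung n" using p by (simp add: n_def)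
      have pne: "p \<noteq> []" using rung_path[of n] unfolding p by (rule is_path_neq_Nil)
      have "set p \<subseteq> pverts G" unfolding p rung_set using ray_in_pverts[OF R] by blast
      moreover have "set p \<inter> range (S e) \<subseteq> {hd p}"
      proof
        fix x assume x: "x \<in> set p \<inter> range (S e)"
        then have "x \<in> R ` {a (Suc n)..b n}" unfolding p rung_set by blast
        then obtain i where i: "x = R i" "a (Suc n) \<le> i" "i \<le> b n" by auto
        then obtain m where "inS i (2 * m + e)" using x S_R by blast
        then have "i = b n" using inS_rung[OF i(2,3)] en by fastforce
        then show "x \<in> {hd p}" using i(1) by (simp add: p rung_hd)
      qed
      moreover have "hd p \<in> range (S e)"
      proof -
        have "inS (b n) (2 * k + e)" using ab(3)[of n] by (simp add: inS_def n_def)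
        then show ?thesis unfolding p rung_hd S_R by blast
      qed
      moreover have "set p \<inter> range (S (1 - e)) \<subseteq> {last p}"
      proof
        fix x assume x: "x \<in> set p \<inter> range (S (1 - e))"
        then have "x \<in> R ` {a (Suc n)..b n}" unfolding p rung_set by blast
        then obtain i where i: "x = R i" "a (Suc n) \<le> i" "i \<le> b n" by auto
        then obtain m where "inS i (2 * m + (1 - e))" using x S_R by blast
        moreover have "odd (2 * m + (1 - e) + n)" using en odd_e by presburger
        ultimately have "i = a (Suc n)" using inS_rung[OF i(2,3)] by blast
        then show "x \<in> {last p}" using i(1) by (simp add: p rung_last)
      qed
      moreover have "last p \<in> range (S (1 - e))"
      proof -
        have "Suc n = 2 * (k + e) + (1 - e)" using e by (auto simp: n_def)
        then have "inS (a (Suc n)) (2 * (k + e) + (1 - e))" by (simp add: inS_def)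
        then show ?thesis unfolding p rung_last S_R by blast
      qed
      ultimately show ?thesis using rung_path[of n] hd_in_set[OF pne] last_in_set[OF pne]
        unfolding p by blast
    qed
    moreover have "set p \<inter> set q = {}" if pq: "p \<in> F" "q \<in> F" "p \<noteq> q" for p q
    proof -
      have *: "set (rung (2 * k + e)) \<inter> set (rung (2 * l + e)) = {}" if "k < l" for k l
      proof -
        have "b (2 * k + e) < a (Suc (2 * l + e))"
          using ab(3)[of "2 * k + e"] a_less[of "Suc (Suc (2 * k + e))" "Suc (2 * l + e)"] that by simp
        then show ?thesis unfolding rung_set by (auto simp: R_eq)
      qed
      obtain k l where kl: "p = rung (2 * k + e)" "q = rung (2 * l + e)" using pq by (auto simp: F_def)
      then show ?thesis using pq(3) *[of k l] *[of l k]
        by (cases k l rule: linorder_cases) auto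
    qed
    ultimately have "\<exists>H. subgraph (with_proj H) (with_proj G) \<and> is_ladder H \<and>
      range (S e) \<union> range (S (1 - e)) \<union> (\<Union>p\<in>F. set p) \<subseteq> pverts H"
      using ladderI[OF S(1) S(1) S_disj[OF odd_e]] by blast
    then show ?thesis by (simp add: W_def F_def)
  qed
  have cover: "R i \<in> W 0 \<union> W 1" if i: "b 0 \<le> i" for i
  proof -
    have "n \<le> b n" for n using b_less by (induction n) (auto simp: Suc_le_eq intro: le_less_trans)
    then have ex: "i < b (Suc i)" by (meson Suc_le_lessD)
    define k where "k = (LEAST k. i < b k)"
    have k: "i < b k" unfolding k_def using ex by (rule LeastI)
    have "k \<noteq> 0" using i k by (metis not_le)
    then obtain n where n: "k = Suc n" using not0_implies_Suc by blast
    have "\<not> i < b n" using not_less_Least[of n "\<lambda>k. i < b k"] n by (simp add: k_def)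
    show ?thesis
    proof (cases "i \<le> a (n + 2)")
      case True
      then have "inS i n" using \<open>\<not> i < b n\<close> by (simp add: inS_def)
      moreover have "n = 2 * (n div 2) + n mod 2" by simp
      ultimately have "R i \<in> range (S (n mod 2))" unfolding S_R by metis
      moreover have "n mod 2 = 0 \<or> n mod 2 = 1" by auto
      ultimately show ?thesis by (auto simp: W_def)
    next
      case False
      then have "R i \<in> set (rung k)" using k n by (simp add: rung_set)
      moreover have "k = 2 * (k div 2) + k mod 2" by simp
      ultimately have "R i \<in> W (k mod 2)" unfolding W_def by (metis UN_I UNIV_I UnI2)
      moreover have "k mod 2 = 0 \<or> k mod 2 = 1" by auto
      ultimately show ?thesis by auto
    qed
  qed
  have "U \<inter> range R \<subseteq> R ` {..<b 0} \<union> (U \<inter> W 0) \<union> (U \<inter> W 1)"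
    using cover by (force simp: not_le)
  then have "infinite (U \<inter> W 0) \<or> infinite (U \<inter> W 1)"
    using U by (meson finite_UnI finite_imageI finite_lessThan finite_subset)
  then obtain e where e: "e \<in> {0, 1}" "infinite (U \<inter> W e)" by blast
  obtain H where H: "subgraph (with_proj H) (with_proj G)" "is_ladder H" "W e \<subseteq> pverts H"
    using ladder[OF e(1)] by blast
  have "infinite (pverts H \<inter> U)"
    using e(2) by (rule contrapos_nn) (rule finite_subset[rotated], use H(3) in auto)
  then show ?thesis using H by blast
qed

text \<open>
  If no vertex of \<open>R\<close> starts ears that reach arbitrarily far, let \<open>reach i\<close> be the furthest position
  reached by an ear (or an edge of \<open>R\<close>) that starts before position \<open>i\<close>. It exceeds \<open>i\<close>, because
  \<open>R i\<close> does not separate the vertices of \<open>R\<close> before it from those after it. Iterating \<open>reach\<close> gives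
  the positions \<open>c n\<close>, and the ears that attain them are interleaved by maximality.
\<close>

lemma ray_ladder_or_fan:
  assumes R: "ray (parcs G) R" and U: "infinite (U \<inter> range R)"
  shows "\<exists>H. subgraph (with_proj H) (with_proj G) \<and> (is_ladder H \<or> is_fan H) \<and> infinite (pverts H \<inter> U)"
proof -
  note R_eq = ray_eq_iff[OF R]
  define jmp where "jmp j k \<longleftrightarrow> (\<exists>p. is_path (parcs G) p \<and> hd p = R j \<and> last p = R k \<and>
      set p \<inter> range R \<subseteq> {R j, R k})" for j k
  show ?thesis
  proof (cases "\<exists>j. \<forall>N. \<exists>k\<ge>N. jmp j k")
    case True
    then obtain j where "\<And>N. \<exists>k\<ge>N. jmp j k" by blast
    then obtain H where H: "subgraph (with_proj H) (with_proj G)" "is_ladder H \<or> is_fan H"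
      "R ` {j<..} \<subseteq> pverts H"
      using cofinal_ears_ladder_or_fan[OF R, of j] unfolding jmp_def by blast
    have "U \<inter> range R \<subseteq> R ` {..j} \<union> (pverts H \<inter> U)"
      using H(3) by (force simp: not_le)
    then have "infinite (pverts H \<inter> U)"
      using U by (meson finite_UnI finite_imageI finite_atMost finite_subset)
    then show ?thesis using H by blast
  next
    case False
    then obtain N where N: "\<And>j k. jmp j k \<Longrightarrow> k < N j" by (metis not_le)
    have over: "\<exists>j<i. \<exists>k>i. jmp j k" if i0: "i > 0" for i
    proof -
      have RV: "R k \<in> pverts G" for k using ray_in_pverts[OF R] by auto
      have "(R 0, R (Suc i)) \<in> avoid (parcs G) {R i}"
        using i0 RV by (intro conn) (auto simp: R_eq)
      then obtain p where p: "is_path (parcs G) p" "hd p = R 0" "last p \<in> R ` {i<..}"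
        "set p \<inter> R ` {i<..} \<subseteq> {last p}" "set p \<inter> {R i} = {}"
        using first_hit_path[of "R 0" "R (Suc i)" "parcs G" "{R i}" "R ` {i<..}"] i0
        by (auto simp: R_eq)
      have "hd p \<in> R ` {..<i}" using p(2) i0 by auto
      then obtain q where q: "is_path (parcs G) q" "set q \<subseteq> set p" "hd q \<in> R ` {..<i}" "last q \<in> R ` {i<..}"
        "set q \<inter> R ` {..<i} \<subseteq> {hd q}" "set q \<inter> R ` {i<..} \<subseteq> {last q}"
        using last_hit_subpath[OF p(1) \<open>hd p \<in> R ` {..<i}\<close> p(3,4)] by (elim exE conjE) (rule that)
      obtain j k where jk: "hd q = R j" "last q = R k" "j < i" "i < k" using q(3,4) by auto
      have "range R = R ` {..<i} \<union> {R i} \<union> R ` {i<..}"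
      proof -
        have "UNIV = {..<i} \<union> {i} \<union> {i<..}" by auto
        then show ?thesis by (metis image_Un image_insert image_empty)
      qed
      then have "set q \<inter> range R \<subseteq> {R j, R k}" using q(2,5,6) p(5) jk by auto
      then show ?thesis using q(1) jk unfolding jmp_def by blast
    qed
    define reach where "reach i = Max {k. \<exists>j<i. jmp j k}" for i
    have fin: "finite {k. \<exists>j<i. jmp j k}" for i
    proof -
      have eq: "{k. \<exists>j<i. jmp j k} = (\<Union>j<i. {k. jmp j k})" by auto
      have "finite {k. jmp j k}" for j
      proof (rule finite_subset)
        show "{k. jmp j k} \<subseteq> {..<N j}"
        proof
          fix k assume "k \<in> {k. jmp j k}"
          then show "k \<in> {..<N j}" using N[of j k] by simp
        qed
      qed (rule finite_lessThan)
      then show ?thesis unfolding eq by (intro finite_UN_I finite_lessThan)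
    qed
    have reach_ge: "k \<le> reach i" if "j < i" "jmp j k" for i j k
      unfolding reach_def using that fin by (intro Max_ge) auto
    have reach_gt: "i < reach i" if "i > 0" for i
      using over[OF that] reach_ge by (meson less_le_trans)
    have reach_in: "\<exists>j<i. jmp j (reach i)" if "i > 0" for i
    proof -
      have "{k. \<exists>j<i. jmp j k} \<noteq> {}" using over[OF that] by blast
      then have "reach i \<in> {k. \<exists>j<i. jmp j k}" unfolding reach_def using fin by (rule Max_in[rotated])
      then show ?thesis by simp
    qed
    define c where "c n = (reach ^^ n) 1" for n
    have c_Suc: "c (Suc n) = reach (c n)" for n by (simp add: c_def)
    have c_pos: "0 < c n" for n
    proof (induction n)
      case (Suc n)
      then show ?case using reach_gt[of "c n"] by (simp add: c_Suc)
    qed (simp add: c_def)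
    have c_less: "c n < c (Suc n)" for n using reach_gt[OF c_pos] by (simp add: c_Suc)
    have c_mono: "c m < c n" if "m < n" for m n
      using lift_Suc_mono_less[of c m n] c_less that by simp
    have "\<forall>n. \<exists>j. j < c n \<and> jmp j (c (Suc n))" using reach_in[OF c_pos] by (simp add: c_Suc)
    then obtain a where a: "\<And>n. a n < c n" "\<And>n. jmp (a n) (c (Suc n))" by metis
    define b where "b n = c (Suc n)" for n
    have "\<forall>n. \<exists>p. is_path (parcs G) p \<and> hd p = R (a n) \<and> last p = R (b n) \<and>
      set p \<inter> range R \<subseteq> {R (a n), R (b n)}" using a(2) by (simp add: jmp_def b_def)
    then obtain J where J: "\<And>n. is_path (parcs G) (J n)" "\<And>n. hd (J n) = R (a n)"
      "\<And>n. last (J n) = R (b n)" "\<And>n. set (J n) \<inter> range R \<subseteq> {R (a n), R (b n)}" by metis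
    have ca: "c n \<le> a (Suc n)" for n
    proof (rule leI, rule notI)
      assume "a (Suc n) < c n"
      then have "c (Suc (Suc n)) \<le> c (Suc n)" using reach_ge a(2)[of "Suc n"] c_Suc[of n] by metis
      then show False using c_less[of "Suc n"] by simp
    qed
    \<comment> \<open>If the \<open>m\<close>-th ear met the \<open>n\<close>-th one off \<open>R\<close>, an ear from \<open>R (a m)\<close> would reach \<open>R (b n)\<close>, beyond \<open>reach (c m)\<close>.\<close>
    have disj: "set (J m) \<inter> set (J n) \<subseteq> range R" if mn: "m < n" for m n
    proof
      fix x assume x: "x \<in> set (J m) \<inter> set (J n)"
      show "x \<in> range R"
      proof (rule ccontr)
        assume xR: "x \<notin> range R"
        obtain u v u' v' where uv: "J m = u @ x # v" "J n = u' @ x # v'"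
          using x by (meson IntE split_list)
        define X where "X = range R - {R (a m), R (b n)}"
        have v: "v \<noteq> []" and u': "u' \<noteq> []"
          using uv J(2)[of n] J(3)[of m] xR by auto
        have dist: "distinct (J m)" "distinct (J n)" using J(1) by (auto simp: is_path_def)
        have "is_path (parcs G) (u @ [x])"
          using J(1)[of m] is_path_appendD1[of "parcs G" "u @ [x]" v] unfolding uv(1) by simp
        moreover have "set (u @ [x]) \<inter> X = {}"
        proof -
          have notin: "R (b m) \<notin> set (u @ [x])"
            using J(3)[of m] last_in_set[OF v] v dist(1) unfolding uv(1) by auto
          have sub: "set (u @ [x]) \<subseteq> set (J m)" unfolding uv(1) by auto
          show ?thesis
          proof (rule equals0I)
            fix y assume y: "y \<in> set (u @ [x]) \<inter> X"
            then have "y \<in> range R" "y \<noteq> R (a m)" unfolding X_def by blast+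
            moreover have "y \<in> set (J m)" using y sub by blast
            ultimately have "y = R (b m)" using J(4)[of m] by blast
            then show False using y notin by simp
          qed
        qed
        ultimately have 1: "(hd (u @ [x]), x) \<in> avoid (parcs G) X" by (rule is_path_avoid) simp
        have hd_u: "hd (u @ [x]) = R (a m)" using J(2)[of m] unfolding uv(1) by (cases u) auto
        have "is_path (parcs G) (x # v')"
          using J(1)[of n] is_path_appendD2[of "parcs G" u' "x # v'"] unfolding uv(2) by simp
        moreover have "set (x # v') \<inter> X = {}"
        proof -
          have "R (a n) \<in> set u'"
            using J(2)[of n] hd_in_set[OF u'] u' unfolding uv(2) by auto
          then have notin: "R (a n) \<notin> set (x # v')" using dist(2) unfolding uv(2) by auto
          have sub: "set (x # v') \<subseteq> set (J n)" unfolding uv(2) by auto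
          show ?thesis
          proof (rule equals0I)
            fix y assume y: "y \<in> set (x # v') \<inter> X"
            then have "y \<in> range R" "y \<noteq> R (b n)" unfolding X_def by blast+
            moreover have "y \<in> set (J n)" using y sub by blast
            ultimately have "y = R (a n)" using J(4)[of n] by blast
            then show False using y notin by simp
          qed
        qed
        moreover have "last (x # v') = R (b n)" using J(3)[of n] unfolding uv(2) by simp
        then have "R (b n) \<in> set (x # v')" using last_in_set[of "x # v'"] by simp
        ultimately have "(hd (x # v'), R (b n)) \<in> avoid (parcs G) X" by (rule is_path_avoid)
        then have "(R (a m), R (b n)) \<in> avoid (parcs G) X" using 1 unfolding hd_u by simp
        then obtain p where p: "is_path (parcs G) p" "hd p = R (a m)" "last p \<in> {R (b n)}" "set p \<inter> X = {}"
          using first_hit_path[of "R (a m)" "R (b n)" "parcs G" X "{R (b n)}"] by (auto simp: X_def)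
        have "set p \<inter> range R \<subseteq> {R (a m), R (b n)}" using p(4) unfolding X_def by blast
        then have "jmp (a m) (b n)" using p(1-3) unfolding jmp_def by blast
        then have "b n \<le> b m" using reach_ge[OF a(1)] by (simp add: b_def c_Suc)
        then show False using c_mono[of "Suc m" "Suc n"] mn by (simp add: b_def)
      qed
    qed
    have disj': "set (J m) \<inter> set (J n) \<subseteq> range R" if "m \<noteq> n" for m n
      using that disj[of m n] disj[of n m] by (cases "m < n") auto
    have "a n < a (Suc n)" for n using a(1)[of n] ca[of n] by simp
    moreover have "a (Suc n) < b n" for n using a(1)[of "Suc n"] by (simp add: b_def)
    moreover have "b n \<le> a (Suc (Suc n))" for n using ca[of "Suc n"] by (simp add: b_def)
    ultimately show ?thesis
      using zigzag_ladder[OF R U, of J a b] J disj' by blast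
  qed
qed

end

section \<open>Ears through separated vertices\<close>

definition component :: "'a rel \<Rightarrow> 'a set \<Rightarrow> 'a \<Rightarrow> 'a set" where
  "component E X a = {b. (a, b) \<in> avoid E X}"

lemma self_in_component [simp]: "a \<in> component E X a"
  by (simp add: component_def)

lemma component_eqI:
  assumes "sym E" "b \<in> component E X a"
  shows "component E X b = component E X a"
proof -
  have "(a, b) \<in> avoid E X" "(b, a) \<in> avoid E X"
    using assms(2) avoid_sym[OF assms(1)] by (auto simp: component_def)
  then show ?thesis unfolding component_def by (auto intro: rtrancl_trans)
qed

lemma component_avoids: "a \<notin> X \<Longrightarrow> component E X a \<inter> X = {}"
  by (auto simp: component_def elim: rtranclE)

lemma component_closed:
  assumes "x \<in> component E X a" "(x, y) \<in> E" "x \<notin> X" "y \<notin> X"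
  shows "y \<in> component E X a"
  using assms by (auto simp: component_def intro: rtrancl_into_rtrancl)

lemma component_mono: "X \<subseteq> Y \<Longrightarrow> component E Y a \<subseteq> component E X a"
  unfolding component_def by (auto elim!: rtrancl_mono[THEN subsetD, rotated])

lemma ear_interior_connected:
  assumes "sym E" "ear E S e" "u \<in> set e - S" "v \<in> set e - S"
  shows "(u, v) \<in> avoid E S"
proof -
  have e: "is_path E e" "hd e \<in> S" "last e \<in> S" "set e \<inter> S \<subseteq> {hd e, last e}" "hd e \<noteq> last e"
    using assms(2) by (auto simp: ear_def)
  then obtain m where m: "e = hd e # m @ [last e]"
    by (metis append_butlast_last_id append_Nil is_path_neq_Nil last_ConsL last_ConsR list.collapse)
  have dist: "hd e \<notin> set m" "last e \<notin> set m"
    using e(1) arg_cong[OF m, of distinct] by (auto simp: is_path_def)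
  have set_e: "set e = insert (hd e) (insert (last e) (set m))"
    using arg_cong[OF m, of set] by auto
  have uv: "u \<in> set m" "v \<in> set m" using assms(3,4) e(2,3) set_e by auto
  then have "m \<noteq> []" by auto
  have "is_path E (m @ [last e])"
    using e(1) m is_path_appendD2[of E "[hd e]" "m @ [last e]"] by simp
  then have "is_path E m" using \<open>m \<noteq> []\<close> by (rule is_path_appendD1)
  moreover have "set m \<inter> S = {}" using e(4) dist set_e by blast
  ultimately have "(hd m, u) \<in> avoid E S" "(hd m, v) \<in> avoid E S"
    using uv by (auto intro: is_path_avoid)
  then show ?thesis using avoid_sym[OF assms(1)] by (meson rtrancl_trans)
qed

context two_connected_graph
begin

text \<open>
  The interior of an \<open>S\<close>-ear lies in a single component of the graph without \<open>S\<close>, so ears through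
  different components can only share their ends.
\<close>

lemma separated_ears:
  assumes "s1 \<in> S \<inter> pverts G" "s2 \<in> S \<inter> pverts G" "s1 \<noteq> s2"
    and W: "W \<subseteq> pverts G - S" "inj_on (component (parcs G) S) W"
  obtains q where "\<And>w. w \<in> W \<Longrightarrow> ear (parcs G) S (q w) \<and> w \<in> set (q w) \<and> set (q w) \<subseteq> pverts G"
    "\<And>v w. v \<in> W \<Longrightarrow> w \<in> W \<Longrightarrow> v \<noteq> w \<Longrightarrow> set (q v) \<inter> set (q w) \<subseteq> S"
proof -
  have "\<forall>w\<in>W. \<exists>e. ear (parcs G) S e \<and> w \<in> set e"
    using ear_through[OF _ assms(1-3)] W(1) by blast
  then obtain q where q: "\<And>w. w \<in> W \<Longrightarrow> ear (parcs G) S (q w) \<and> w \<in> set (q w)" by metis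
  have "set (q w) \<subseteq> pverts G" if w: "w \<in> W" for w
  proof -
    have path: "is_path (parcs G) (q w)" using q[OF w] by (simp add: ear_def)
    obtain u v where uv: "q w = u @ w # v" using q[OF w] by (meson split_list)
    have "hd (q w) \<in> pverts G"
    proof (cases u)
      case Nil
      then show ?thesis using uv W(1) w by auto
    next
      case (Cons x u')
      have "(x, hd (u' @ w # v)) \<in> parcs G"
        using path unfolding uv Cons by (simp add: is_path_Cons)
      then show ?thesis using parcs_pverts uv Cons by auto
    qed
    then show ?thesis using path by (intro is_path_V)
  qed
  moreover have "set (q v) \<inter> set (q w) \<subseteq> S" if vw: "v \<in> W" "w \<in> W" "v \<noteq> w" for v w
  proof (rule ccontr)
    assume "\<not> set (q v) \<inter> set (q w) \<subseteq> S"
    then obtain x where x: "x \<in> set (q v) - S" "x \<in> set (q w) - S" by blast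
    have "v \<in> set (q v) - S" "w \<in> set (q w) - S" using q vw W(1) by auto
    then have "(v, x) \<in> avoid (parcs G) S" "(x, w) \<in> avoid (parcs G) S"
      using ear_interior_connected[OF sym_parcs] q vw(1,2) x by blast+
    then have "w \<in> component (parcs G) S v" unfolding component_def by (auto intro: rtrancl_trans)
    then have "component (parcs G) S w = component (parcs G) S v"
      by (rule component_eqI[OF sym_parcs])
    then show False using W(2) vw by (auto simp: inj_on_def)
  qed
  ultimately show thesis using that q by blast
qed

lemma parallel_paths_K_2_omega:
  assumes W: "infinite W" "W \<subseteq> U" and "c \<noteq> d"
    and q: "\<And>w. w \<in> W \<Longrightarrow> is_path (parcs G) (q w) \<and> set (q w) \<subseteq> pverts G \<and>
      hd (q w) = c \<and> last (q w) = d \<and> w \<in> set (q w) \<and> w \<notin> {c, d}"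
    and disj: "\<And>v w. v \<in> W \<Longrightarrow> w \<in> W \<Longrightarrow> v \<noteq> w \<Longrightarrow> set (q v) \<inter> set (q w) \<subseteq> {c, d}"
  shows "\<exists>H. subgraph (with_proj H) (with_proj G) \<and> is_subdivision_of H K_2_omega \<and>
    infinite (pverts H \<inter> U)"
proof -
  obtain u :: "nat \<Rightarrow> 'a" where u: "inj u" "range u \<subseteq> W"
    using infinite_countable_subset[OF W(1)] by blast
  have uW: "u n \<in> W" for n using u(2) by blast
  have "\<exists>H. subgraph (with_proj H) (with_proj G) \<and> is_subdivision_of H K_2_omega \<and>
      (\<Union>n. set (q (u n))) \<subseteq> pverts H"
  proof (rule K_2_omega_subdivisionI[OF \<open>c \<noteq> d\<close>, of "\<lambda>n. q (u n)" u])
    show "set (q (u m)) \<inter> set (q (u n)) \<subseteq> {c, d}" if "m \<noteq> n" for m n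
      using disj[OF uW uW] u(1) that by (auto simp: inj_eq)
  qed (use q[OF uW] in auto)
  then obtain H where H: "subgraph (with_proj H) (with_proj G)" "is_subdivision_of H K_2_omega"
    "(\<Union>n. set (q (u n))) \<subseteq> pverts H" by blast
  have "range u \<subseteq> pverts H \<inter> U" using H(3) q[OF uW] uW W(2) by blast
  then have "infinite (pverts H \<inter> U)" using range_inj_infinite[OF u(1)] finite_subset by blast
  then show ?thesis using H by blast
qed

text \<open>
  By 2-connectedness \<open>X\<close> has at least two vertices, since it separates any two vertices of \<open>W\<close>; so
  there are \<open>X\<close>-ears through the vertices of \<open>W\<close>. Only finitely many pairs of ends are available.
\<close>

lemma finite_separator_K_2_omega:
  assumes X: "finite X" "X \<subseteq> pverts G"
    and W: "infinite W" "W \<subseteq> U" "W \<subseteq> pverts G - X" "inj_on (component (parcs G) X) W"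
  shows "\<exists>H. subgraph (with_proj H) (with_proj G) \<and> is_subdivision_of H K_2_omega \<and>
    infinite (pverts H \<inter> U)"
proof -
  have "\<not> card X < 2"
  proof
    assume "card X < 2"
    then have "w \<in> component (parcs G) X v" if "v \<in> W" "w \<in> W" for v w
      using conn[OF X(1)] that W(3) by (auto simp: component_def)
    then have "v = w" if "v \<in> W" "w \<in> W" for v w
      using component_eqI[OF sym_parcs] W(4) that by (meson inj_onD)
    then show False using W(1) by (metis finite.simps infinite_imp_nonempty insert_iff subsetI subset_antisym ex_in_conv finite_subset singletonI)
  qed
  then obtain T where "T \<subseteq> X" "card T = 2" using obtain_subset_with_card_n[of 2 X] by auto
  then obtain s1 s2 where s: "s1 \<in> X \<inter> pverts G" "s2 \<in> X \<inter> pverts G" "s1 \<noteq> s2"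
    using X(2) unfolding card_2_iff by blast
  obtain q where q: "\<And>w. w \<in> W \<Longrightarrow> ear (parcs G) X (q w) \<and> w \<in> set (q w) \<and> set (q w) \<subseteq> pverts G"
    "\<And>v w. v \<in> W \<Longrightarrow> w \<in> W \<Longrightarrow> v \<noteq> w \<Longrightarrow> set (q v) \<inter> set (q w) \<subseteq> X"
    using separated_ears[OF s W(3,4)] by blast
  have "(\<lambda>w. (hd (q w), last (q w))) ` W \<subseteq> X \<times> X" using q(1) by (auto simp: ear_def)
  then have "finite ((\<lambda>w. (hd (q w), last (q w))) ` W)" using X(1) by (meson finite_SigmaI finite_subset)
  then obtain w0 where w0: "w0 \<in> W"
    "infinite {w \<in> W. (hd (q w), last (q w)) = (hd (q w0), last (q w0))}"
    using pigeonhole_infinite[OF W(1)] by blast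
  define C where "C = {w \<in> W. (hd (q w), last (q w)) = (hd (q w0), last (q w0))}"
  have C: "w \<in> W" "hd (q w) = hd (q w0)" "last (q w) = last (q w0)" if "w \<in> C" for w
    using that by (auto simp: C_def)
  show ?thesis
  proof (rule parallel_paths_K_2_omega[of C U "hd (q w0)" "last (q w0)" q])
    show "infinite C" using w0(2) by (simp add: C_def)
    show "C \<subseteq> U" using C(1) W(2) by blast
    show "hd (q w0) \<noteq> last (q w0)" using q(1)[OF w0(1)] by (simp add: ear_def)
  next
    fix w assume w: "w \<in> C"
    have "hd (q w0) \<in> X" "last (q w0) \<in> X" using q(1)[OF w0(1)] by (auto simp: ear_def)
    moreover have "w \<notin> X" using C(1)[OF w] W(3) by blast
    ultimately show "is_path (parcs G) (q w) \<and> set (q w) \<subseteq> pverts G \<and>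
      hd (q w) = hd (q w0) \<and> last (q w) = last (q w0) \<and> w \<in> set (q w) \<and> w \<notin> {hd (q w0), last (q w0)}"
      using q(1)[OF C(1)[OF w]] C(2,3)[OF w] unfolding ear_def by blast
  next
    fix v w assume vw: "v \<in> C" "w \<in> C" "v \<noteq> w"
    have "set (q v) \<inter> X \<subseteq> {hd (q w0), last (q w0)}"
      using q(1)[OF C(1)[OF vw(1)]] C(2,3)[OF vw(1)] unfolding ear_def by metis
    then show "set (q v) \<inter> set (q w) \<subseteq> {hd (q w0), last (q w0)}"
      using q(2)[OF C(1)[OF vw(1)] C(1)[OF vw(2)] vw(3)] by blast
  qed
qed

end

section \<open>A ray towards infinitely many vertices of U\<close>

context two_connected_graph
begin

text \<open>
  One step of the depth-first search, from a component of the graph without \<open>X\<close> to one of the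
  components into which the deletion of its vertex \<open>y\<close> splits it. Only finitely many of these meet
  \<open>U\<close>, so one of them contains infinitely many vertices of \<open>U\<close>; and it has an edge to \<open>y\<close>, since the
  component that was split is connected.
\<close>

lemma deeper_component:
  assumes few: "\<forall>W. W \<subseteq> U - insert y X \<longrightarrow> inj_on (component (parcs G) (insert y X)) W \<longrightarrow> finite W"
    and UV: "U \<subseteq> pverts G"
    and a: "a \<in> pverts G - X" and y: "y \<in> component (parcs G) X a"
    and inf: "infinite (component (parcs G) X a \<inter> U)"
  obtains a' where "a' \<in> pverts G - insert y X"
    "component (parcs G) (insert y X) a' \<subseteq> component (parcs G) X a"
    "infinite (component (parcs G) (insert y X) a' \<inter> U)"
    "\<exists>x\<in>component (parcs G) (insert y X) a'. (y, x) \<in> parcs G"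
proof -
  let ?C = "component (parcs G)"
  let ?X = "insert y X"
  define A where "A = ?C X a \<inter> U - {y}"
  have "infinite A" using inf by (simp add: A_def)
  have "A \<subseteq> U - ?X" using component_avoids[of a X "parcs G"] a by (auto simp: A_def)
  have "\<exists>Y. infinite {x \<in> A. ?C ?X x = Y}"
  proof (rule infinite_const_or_inj[OF \<open>infinite A\<close>, of "?C ?X"])
    fix B assume B: "B \<subseteq> A" "infinite B" "inj_on (?C ?X) B"
    then show ?thesis using few \<open>A \<subseteq> U - ?X\<close> by blast
  qed blast
  then obtain Y where Y: "infinite {x \<in> A. ?C ?X x = Y}" by blast
  then obtain a' where a': "a' \<in> A" "?C ?X a' = Y" using not_finite_existsD by fastforce
  have a'X: "a' \<in> pverts G - ?X" using a'(1) \<open>A \<subseteq> U - ?X\<close> UV by blast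
  have "{x \<in> A. ?C ?X x = Y} \<subseteq> ?C ?X a' \<inter> U"
  proof
    fix x assume x: "x \<in> {x \<in> A. ?C ?X x = Y}"
    then have "?C ?X x = ?C ?X a'" using a'(2) by simp
    then have "x \<in> ?C ?X a'" using self_in_component by metis
    then show "x \<in> ?C ?X a' \<inter> U" using x by (auto simp: A_def)
  qed
  then have 1: "infinite (?C ?X a' \<inter> U)" using Y finite_subset by blast
  have eq: "?C X a' = ?C X a" using component_eqI[OF sym_parcs] a'(1) by (auto simp: A_def)
  then have 2: "?C ?X a' \<subseteq> ?C X a" using component_mono[of X ?X "parcs G" a'] by blast
  have "(a', y) \<in> avoid (parcs G) X" using y eq by (auto simp: component_def)
  moreover have "y \<notin> ?C ?X a'" using component_avoids[of a' ?X "parcs G"] a'X by blast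
  ultimately obtain x z where xz: "x \<in> ?C ?X a'" "z \<notin> ?C ?X a'" "(x, z) \<in> parcs G \<inter> (- X) \<times> (- X)"
    using rtrancl_leaves_set[of a' y _ "?C ?X a'"] self_in_component by metis
  have "x \<notin> ?X" using component_avoids[of a' ?X "parcs G"] a'X xz(1) by blast
  then have "z = y" using component_closed[OF xz(1), of z] xz(2,3) by blast
  then have 3: "\<exists>x\<in>?C ?X a'. (y, x) \<in> parcs G" using xz(1,3) E_sym by blast
  show thesis using that[OF a'X 2 1 3] .
qed

text \<open>
  A state of the search consists of the set \<open>X\<close> of vertices visited so far, the current vertex \<open>r\<close>, and
  a component \<open>K\<close> of the graph without \<open>X\<close> that is adjacent to \<open>r\<close> and contains infinitely many
  vertices of \<open>U\<close>. The next vertex \<open>r'\<close> is the first one on a shortest path through \<open>K\<close> from a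
  neighbour of \<open>r\<close> to the target \<open>tgt K\<close>, the vertex of \<open>K\<close> with least index. As long as the target
  stays in the component, its distance \<open>D\<close> decreases with every step: the rest of the shortest path
  avoids \<open>r'\<close> and hence stays in the component of the target. So every target leaves the component
  eventually, and the least index of a vertex in \<open>K k\<close> tends to infinity.
\<close>

lemma vanishing_ray:
  assumes count: "countable (pverts G)" and UV: "U \<subseteq> pverts G" and U: "infinite U"
    and few: "\<forall>X W. finite X \<longrightarrow> X \<subseteq> pverts G \<longrightarrow> W \<subseteq> U - X \<longrightarrow>
      inj_on (component (parcs G) X) W \<longrightarrow> finite W"
  obtains R K where "ray (parcs G) R" "\<And>k. K (Suc k) \<subseteq> K k" "\<And>k. infinite (K k \<inter> U)"
    "\<And>k x y. x \<in> K k \<Longrightarrow> (x, y) \<in> parcs G \<Longrightarrow> y \<in> K k \<or> y \<in> range R"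
    "\<And>v. v \<in> pverts G \<Longrightarrow> \<exists>k. v \<notin> K k"
proof -
  let ?C = "component (parcs G)"
  define idx where "idx = to_nat_on (pverts G)"
  have idx_inj: "idx v = idx w \<longleftrightarrow> v = w" if "v \<in> pverts G" "w \<in> pverts G" for v w
    using inj_on_to_nat_on[OF count] that by (auto simp: idx_def inj_on_def)
  define tgt where "tgt K = arg_min idx (\<lambda>v. v \<in> K)" for K
  have tgt: "tgt K \<in> K" "\<And>v. v \<in> K \<Longrightarrow> idx (tgt K) \<le> idx v" if "v0 \<in> K" for K v0
    using arg_min_nat_lemma[of "\<lambda>v. v \<in> K" v0 idx] that unfolding tgt_def by auto
  define good where "good X r K \<longleftrightarrow> finite X \<and> X \<subseteq> pverts G \<and> r \<in> X \<and>
    (\<exists>a\<in>pverts G - X. K = ?C X a) \<and> infinite (K \<inter> U) \<and> (\<exists>x\<in>K. (r, x) \<in> parcs G)" for X r K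
  define reaches where "reaches r K n \<longleftrightarrow>
    (\<exists>p. is_path (parcs G) p \<and> (r, hd p) \<in> parcs G \<and> last p = tgt K \<and> set p \<subseteq> K \<and> length p = n)" for r K n
  define D where "D r K = (LEAST n. reaches r K n)" for r K
  have good_V: "K \<subseteq> pverts G" "K \<inter> X = {}" if gd: "good X r K" for X r K
  proof -
    obtain a where a: "a \<in> pverts G - X" "K = ?C X a" using gd by (auto simp: good_def)
    show "K \<inter> X = {}" using component_avoids[of a X "parcs G"] a by blast
    show "K \<subseteq> pverts G"
    proof
      fix b assume "b \<in> K"
      then have "(a, b) \<in> avoid (parcs G) X" using a by (simp add: component_def)
      then show "b \<in> pverts G" using a(1) by (induction rule: rtrancl_induct) (use parcs_pverts in auto)
    qed
  qed
  have step: "\<exists>r' K'. good (insert r' X) r' K' \<and> r' \<in> K \<and> (r, r') \<in> parcs G \<and> K' \<subseteq> K \<and>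
      (tgt K \<in> K' \<longrightarrow> tgt K' = tgt K \<and> D r' K' < D r K)" if g: "good X r K" for X r K
  proof -
    obtain a where a: "a \<in> pverts G - X" "K = ?C X a" and X: "finite X" "X \<subseteq> pverts G"
      using g by (auto simp: good_def)
    obtain y where y: "y \<in> K" "(r, y) \<in> parcs G" using g by (auto simp: good_def)
    have "(y, tgt K) \<in> avoid (parcs G) X"
    proof -
      have "?C X y = K" using component_eqI[OF sym_parcs, of y X a] y(1) a(2) by simp
      then show ?thesis using tgt(1)[OF y(1)] by (auto simp: component_def)
    qed
    moreover have "y \<notin> X" using good_V(2)[OF g] y(1) by blast
    ultimately obtain p where p: "is_path (parcs G) p" "hd p = y" "last p \<in> {tgt K}" "set p \<inter> X = {}"
      using first_hit_path[of y "tgt K" "parcs G" X "{tgt K}"] by auto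
    have in_comp: "set q \<subseteq> ?C X' b" if "is_path (parcs G) q" "set q \<inter> X' = {}" "x \<in> set q" "x \<in> ?C X' b"
      for q X' b x
    proof
      fix z assume "z \<in> set q"
      then have "(hd q, z) \<in> avoid (parcs G) X'" "(hd q, x) \<in> avoid (parcs G) X'"
        using that by (auto intro: is_path_avoid)
      then have "(x, z) \<in> avoid (parcs G) X'" using avoid_sym[OF sym_parcs] by (meson rtrancl_trans)
      then show "z \<in> ?C X' b" using that(4) by (auto simp: component_def intro: rtrancl_trans)
    qed
    have "y \<in> set p" using p(1,2) is_path_neq_Nil hd_in_set by metis
    then have "set p \<subseteq> K" using in_comp[OF p(1,4) _ y(1)[unfolded a(2)]] a(2) by blast
    then have "reaches r K (length p)" unfolding reaches_def using p y(2) by blast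
    then have "reaches r K (D r K)" unfolding D_def by (rule LeastI)
    then obtain p where p: "is_path (parcs G) p" "(r, hd p) \<in> parcs G" "last p = tgt K" "set p \<subseteq> K"
      "length p = D r K" unfolding reaches_def by blast
    have pne: "p \<noteq> []" using p(1) by (rule is_path_neq_Nil)
    define r' where "r' = hd p"
    have r'K: "r' \<in> K" using p(4) hd_in_set[OF pne] by (auto simp: r'_def)
    have r'V: "r' \<in> pverts G" using r'K good_V(1)[OF g] by blast
    have inf: "infinite (?C X a \<inter> U)" using g a(2) by (simp add: good_def)
    have few': "\<forall>W. W \<subseteq> U - insert r' X \<longrightarrow> inj_on (?C (insert r' X)) W \<longrightarrow> finite W"
      using few[rule_format, of "insert r' X"] X r'V by simp
    obtain a' where a': "a' \<in> pverts G - insert r' X" "?C (insert r' X) a' \<subseteq> ?C X a"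
      "infinite (?C (insert r' X) a' \<inter> U)" "\<exists>x\<in>?C (insert r' X) a'. (r', x) \<in> parcs G"
      using deeper_component[OF few' UV a(1) r'K[unfolded a(2)] inf] by blast
    define K' where "K' = ?C (insert r' X) a'"
    have g': "good (insert r' X) r' K'"
      using a' X r'V unfolding good_def K'_def by blast
    have K': "K' \<subseteq> K" using a'(2) by (simp add: K'_def a(2))
    have "tgt K' = tgt K \<and> D r' K' < D r K" if t: "tgt K \<in> K'"
    proof
      have "idx (tgt K') \<le> idx (tgt K)" using tgt(2)[OF t t] .
      moreover have "idx (tgt K) \<le> idx (tgt K')" using tgt(2)[OF r'K] tgt(1)[OF t] K' by blast
      ultimately show eq: "tgt K' = tgt K"
        using idx_inj[of "tgt K'" "tgt K"] tgt(1)[OF t] t good_V(1)[OF g'] by auto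
      have r'K': "r' \<notin> K'" using good_V(2)[OF g'] by blast
      obtain p' where p': "p = r' # p'" using pne by (cases p) (auto simp: r'_def)
      have "p' \<noteq> []" using p(3) p' t r'K' by auto
      then have pp: "is_path (parcs G) p'" "r' \<notin> set p'" "(r', hd p') \<in> parcs G" "last p' = tgt K"
        using p(1,3) unfolding p' by (auto simp: is_path_Cons)
      have "set p' \<inter> insert r' X = {}" using pp(2) p(4) p' good_V(2)[OF g] by auto
      moreover have "tgt K \<in> set p'" using last_in_set[OF \<open>p' \<noteq> []\<close>] pp(4) by simp
      ultimately have "set p' \<subseteq> K'" using in_comp[OF pp(1)] t unfolding K'_def by blast
      then have "reaches r' K' (length p')" unfolding reaches_def using pp eq by auto
      then have "D r' K' \<le> length p'" unfolding D_def by (rule Least_le)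
      then show "D r' K' < D r K" using p(5) p' by simp
    qed
    then show ?thesis using g' r'K p(2) K' by (auto simp: r'_def)
  qed
  obtain v0 where v0: "v0 \<in> U" using infinite_imp_nonempty[OF U] by blast
  have all: "?C {} v0 \<inter> U = U"
    using conn[of "{}" v0] v0 UV by (auto simp: component_def)
  have init: "\<exists>K. good {v0} v0 K"
  proof -
    have v0V: "v0 \<in> pverts G - {}" and inf0: "infinite (?C {} v0 \<inter> U)"
      using v0 UV U by (auto simp: all)
    have few0: "\<forall>W. W \<subseteq> U - insert v0 {} \<longrightarrow> inj_on (?C (insert v0 {})) W \<longrightarrow> finite W"
      using few[rule_format, of "{v0}"] v0 UV by auto
    obtain a' where a': "a' \<in> pverts G - insert v0 {}" "?C (insert v0 {}) a' \<subseteq> ?C {} v0"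
      "infinite (?C (insert v0 {}) a' \<inter> U)" "\<exists>x\<in>?C (insert v0 {}) a'. (v0, x) \<in> parcs G"
      by (rule deeper_component[OF few0 UV v0V self_in_component inf0]) (rule that)
    then have "good {v0} v0 (?C {v0} a')" unfolding good_def using v0V by blast
    then show ?thesis by blast
  qed
  define P where "P n s \<longleftrightarrow> good (fst s) (fst (snd s)) (snd (snd s)) \<and> (n = 0 \<longrightarrow> fst s = {fst (snd s)})" for n :: nat and s
  define Q where "Q n s s' \<longleftrightarrow> (case s of (X, r, K) \<Rightarrow> case s' of (X', r', K') \<Rightarrow>
    X' = insert r' X \<and> r' \<in> K \<and> (r, r') \<in> parcs G \<and> K' \<subseteq> K \<and>
    (tgt K \<in> K' \<longrightarrow> tgt K' = tgt K \<and> D r' K' < D r K))" for n :: nat and s s'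
  have "\<exists>f. \<forall>n. P n (f n) \<and> Q n (f n) (f (Suc n))"
  proof (rule dependent_nat_choice)
    obtain K where "good {v0} v0 K" using init by blast
    then show "\<exists>s. P 0 s" by (intro exI[of _ "({v0}, v0, K)"]) (simp add: P_def)
  next
    fix s n assume s: "P n s"
    obtain X r K where XrK: "s = (X, r, K)" by (cases s)
    then obtain r' K' where "good (insert r' X) r' K'" "r' \<in> K" "(r, r') \<in> parcs G" "K' \<subseteq> K"
      "tgt K \<in> K' \<longrightarrow> tgt K' = tgt K \<and> D r' K' < D r K"
      using step[of X r K] s by (auto simp: P_def)
    then show "\<exists>s'. P (Suc n) s' \<and> Q n s s'"
      unfolding XrK by (intro exI[of _ "(insert r' X, r', K')"]) (simp add: P_def Q_def)
  qed
  then obtain f where f: "\<And>n. P n (f n)" "\<And>n. Q n (f n) (f (Suc n))" by blast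
  define X where "X n = fst (f n)" for n
  define R where "R n = fst (snd (f n))" for n
  define K where "K n = snd (snd (f n))" for n
  have f_eq: "f n = (X n, R n, K n)" for n by (simp add: X_def R_def K_def)
  have g: "good (X n) (R n) (K n)" for n using f(1)[of n] by (simp add: P_def f_eq)
  have Q: "X (Suc n) = insert (R (Suc n)) (X n)" "R (Suc n) \<in> K n" "(R n, R (Suc n)) \<in> parcs G"
    "K (Suc n) \<subseteq> K n"
    "tgt (K n) \<in> K (Suc n) \<Longrightarrow> tgt (K (Suc n)) = tgt (K n) \<and> D (R (Suc n)) (K (Suc n)) < D (R n) (K n)" for n
    using f(2)[of n] by (simp_all add: Q_def f_eq)
  have K_mono: "K n \<subseteq> K m" if "m \<le> n" for m n
    using lift_Suc_antimono_le[of K m n] Q(4) that by blast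
  have R_X: "R m \<in> X n" if "m \<le> n" for m n
    using that
  proof (induction n)
    case 0
    then show ?case using g[of 0] by (simp add: good_def)
  next
    case (Suc n)
    then show ?case using Q(1)[of n] by (cases "m = Suc n") auto
  qed
  have R_notin: "R m \<notin> K n" if "m \<le> n" for m n
    using R_X[OF that] good_V(2)[OF g[of n]] by blast
  have R_in: "R n \<in> K m" if mn: "m < n" for m n
  proof -
    obtain n' where n': "n = Suc n'" "m \<le> n'" using mn by (cases n) auto
    then show ?thesis using Q(2)[of n'] K_mono[of m n'] by blast
  qed
  have ray: "ray (parcs G) R"
    unfolding ray_def
  proof (intro conjI allI)
    show "inj R"
    proof (rule linorder_injI)
      fix m n :: nat assume "m < n"
      then show "R m \<noteq> R n" using R_in[of m n] R_notin[of m m] by auto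
    qed
  qed (rule Q(3))
  have X_R: "X n \<subseteq> range R" for n
  proof (induction n)
    case 0
    then show ?case using f(1)[of 0] by (simp add: P_def f_eq)
  next
    case (Suc n)
    then show ?case using Q(1)[of n] by simp
  qed
  have closed: "y \<in> K n \<or> y \<in> range R" if xy: "x \<in> K n" "(x, y) \<in> parcs G" for n x y
  proof -
    obtain a where a: "a \<in> pverts G - X n" "K n = ?C (X n) a" using g[of n] by (auto simp: good_def)
    have "x \<notin> X n" using good_V(2)[OF g[of n]] xy(1) by blast
    then have "y \<in> K n \<or> y \<in> X n" using component_closed[of x "parcs G" "X n" a y] a xy by blast
    then show ?thesis using X_R[of n] by blast
  qed
  have vanish: "\<exists>k. \<forall>v\<in>K k. n \<le> idx v" for n
  proof (induction n)
    case (Suc n)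
    then obtain k where k: "\<And>v. v \<in> K k \<Longrightarrow> n \<le> idx v" by blast
    have ne: "tgt (K k) \<in> K k" for k using tgt(1)[OF Q(2)] .
    have "\<exists>j. tgt (K k) \<notin> K (k + j)"
    proof (rule ccontr)
      assume "\<nexists>j. tgt (K k) \<notin> K (k + j)"
      then have all: "tgt (K k) \<in> K (k + j)" for j by blast
      have same: "tgt (K (k + j)) = tgt (K k)" for j
      proof (induction j)
        case (Suc j)
        then show ?case using Q(5)[of "k + j"] all[of "Suc j"] by simp
      qed simp
      have "D (R (k + j)) (K (k + j)) + j \<le> D (R k) (K k)" for j
      proof (induction j)
        case (Suc j)
        then show ?case using Q(5)[of "k + j"] all[of "Suc j"] same[of j] by simp
      qed simp
      from this[of "Suc (D (R k) (K k))"] show False by simp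
    qed
    then obtain j where j: "tgt (K k) \<notin> K (k + j)" by blast
    have "Suc n \<le> idx v" if v: "v \<in> K (k + j)" for v
    proof -
      have vk: "v \<in> K k" using v K_mono[of k "k + j"] by auto
      have "idx (tgt (K k)) \<le> idx v" using tgt(2)[OF vk vk] .
      moreover have "idx (tgt (K k)) \<noteq> idx v"
        using idx_inj[of "tgt (K k)" v] ne[of k] vk good_V(1)[OF g[of k]] v j by auto
      ultimately show ?thesis using k[OF ne] by simp
    qed
    then show ?case by blast
  qed simp
  show thesis
  proof (rule that[OF ray])
    show "\<exists>k. v \<notin> K k" for v using vanish[of "Suc (idx v)"] by force
    show "infinite (K k \<inter> U)" for k using g[of k] by (simp add: good_def)
  qed (use Q(4) closed in auto)
qed

text \<open>
  Infinitely many ears either agree in their first end or have distinct first ends. In the first case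
  the same alternative for the second end leads to a subdivided \<open>K\<^sub>2\<^sub>,\<^sub>\<omega>\<close> or to a fan. In the second case
  there are ears that start arbitrarily late, so a sequence of ears can be chosen in which each one
  starts no earlier than its predecessor ends, and \<open>R\<close> can be rerouted through all of them.
\<close>

lemma ears_over_ray:
  assumes R: "ray (parcs G) R" and inf_B: "infinite B" and BU: "B \<subseteq> U - range R"
    and q: "\<And>w. w \<in> B \<Longrightarrow> a w < b w" "\<And>w. w \<in> B \<Longrightarrow> is_path (parcs G) (q w)"
      "\<And>w. w \<in> B \<Longrightarrow> hd (q w) = R (a w)" "\<And>w. w \<in> B \<Longrightarrow> last (q w) = R (b w)"
      "\<And>w. w \<in> B \<Longrightarrow> set (q w) \<inter> range R \<subseteq> {R (a w), R (b w)}"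
      "\<And>w. w \<in> B \<Longrightarrow> w \<in> set (q w)" "\<And>w. w \<in> B \<Longrightarrow> set (q w) \<subseteq> pverts G"
    and q_disj: "\<And>v w. v \<in> B \<Longrightarrow> w \<in> B \<Longrightarrow> v \<noteq> w \<Longrightarrow> set (q v) \<inter> set (q w) \<subseteq> range R"
  shows "\<exists>H. subgraph (with_proj H) (with_proj G) \<and>
    (is_ladder H \<or> is_fan H \<or> is_subdivision_of H K_2_omega) \<and> infinite (pverts H \<inter> U)"
proof -
  note R_eq = ray_eq_iff[OF R]
  show ?thesis
  proof (rule infinite_const_or_inj[OF inf_B, of a])
    fix i assume inf_i: "infinite {w \<in> B. a w = i}"
    show ?thesis
    proof (rule infinite_const_or_inj[OF inf_i, of b])
      fix j assume "infinite {w \<in> {w \<in> B. a w = i}. b w = j}"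
      then have inf: "infinite {w \<in> B. a w = i \<and> b w = j}" by simp
      then obtain w0 where w0: "w0 \<in> B" "a w0 = i" "b w0 = j" using not_finite_existsD by fastforce
      have "\<exists>H. subgraph (with_proj H) (with_proj G) \<and> is_subdivision_of H K_2_omega \<and>
        infinite (pverts H \<inter> U)"
      proof (rule parallel_paths_K_2_omega[OF inf, of U "R i" "R j" q])
        show "{w \<in> B. a w = i \<and> b w = j} \<subseteq> U" using BU by auto
        show "R i \<noteq> R j" using q(1)[OF w0(1)] w0 by (simp add: R_eq)
        fix w assume w: "w \<in> {w \<in> B. a w = i \<and> b w = j}"
        then have "w \<notin> range R" using BU by blast
        then show "is_path (parcs G) (q w) \<and> set (q w) \<subseteq> pverts G \<and> hd (q w) = R i \<and>
          last (q w) = R j \<and> w \<in> set (q w) \<and> w \<notin> {R i, R j}"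
          using w q[of w] by blast
        fix v assume v: "v \<in> {w \<in> B. a w = i \<and> b w = j}" and "v \<noteq> w"
        then have "set (q v) \<inter> set (q w) \<subseteq> range R" using q_disj w by simp
        moreover have "set (q v) \<inter> range R \<subseteq> {R i, R j}" using q(5)[of v] v by simp
        ultimately show "set (q v) \<inter> set (q w) \<subseteq> {R i, R j}" by blast
      qed
      then show ?thesis by blast
    next
      fix C assume C: "C \<subseteq> {w \<in> B. a w = i}" "infinite C" "inj_on b C"
      have CB: "w \<in> B" "a w = i" if "w \<in> C" for w using C(1) that by auto
      define R' where "R' k = R (k + Suc i)" for k
      have R': "ray (parcs G) R'" unfolding R'_def by (rule ray_tail[OF R])
      have R'_R: "range R' \<subseteq> range R" by (auto simp: R'_def)
      have Ri: "R i \<notin> range R'" by (auto simp: R'_def R_eq)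
      have bR': "R (b w) \<in> range R'" if "w \<in> C" for w
      proof -
        have "R (b w) = R' (b w - Suc i)" using q(1)[OF CB(1)[OF that]] CB(2)[OF that]
          by (simp add: R'_def R_eq)
        then show ?thesis by simp
      qed
      have "inj_on q C"
      proof (rule inj_onI)
        fix v w assume vw: "v \<in> C" "w \<in> C" "q v = q w"
        then have "R (b v) = R (b w)" using q(4) CB(1) by metis
        then show "v = w" using C(3) vw by (simp add: R_eq inj_on_def)
      qed
      then have inf_q: "infinite (q ` C)" using C(2) by (simp add: finite_image_iff)
      have path_q: "is_path (parcs G) p \<and> set p \<subseteq> pverts G \<and> hd p = R i \<and> set p \<inter> range R' = {last p}"
        if p: "p \<in> q ` C" for p
      proof -
        obtain w where w: "w \<in> C" "p = q w" using p by blast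
        note qw = q[OF CB(1)[OF w(1)]]
        have "A \<inter> S' \<subseteq> {y}" if "A \<inter> S \<subseteq> {x, y}" "S' \<subseteq> S" "x \<notin> S'" for A S S' :: "'a set" and x y
          using that by blast
        from this[OF qw(5) R'_R] have "set (q w) \<inter> range R' \<subseteq> {R (b w)}"
          using Ri CB(2)[OF w(1)] by simp
        moreover have "R (b w) \<in> set (q w)"
          using last_in_set[OF is_path_neq_Nil[OF qw(2)]] qw(4) by simp
        ultimately have "set (q w) \<inter> range R' = {R (b w)}" using bR'[OF w(1)] by blast
        then show ?thesis unfolding w(2) using qw CB(2)[OF w(1)] by simp
      qed
      have disj_q: "set p \<inter> set p' \<subseteq> {R i}" if pp: "p \<in> q ` C" "p' \<in> q ` C" "p \<noteq> p'" for p p'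
      proof -
        obtain v w where vw: "v \<in> C" "w \<in> C" "p = q v" "p' = q w" "v \<noteq> w" using pp by blast
        have "R (b v) \<noteq> R (b w)" using C(3) vw by (auto simp: R_eq inj_on_def)
        moreover have "set p \<inter> set p' \<subseteq> range R" using q_disj CB(1) vw by blast
        moreover have "set p \<inter> range R \<subseteq> {R i, R (b v)}" "set p' \<inter> range R \<subseteq> {R i, R (b w)}"
          using q(5)[OF CB(1)] CB(2) vw by metis+
        ultimately show ?thesis by blast
      qed
      have "\<exists>H. subgraph (with_proj H) (with_proj G) \<and> is_fan H \<and>
          range R' \<union> (\<Union>p\<in>q ` C. set p) \<subseteq> pverts H"
        by (rule fanI[OF R' Ri inf_q path_q disj_q])
      then obtain H where H: "subgraph (with_proj H) (with_proj G)" "is_fan H"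
        "range R' \<union> (\<Union>p\<in>q ` C. set p) \<subseteq> pverts H" by blast
      have "C \<subseteq> pverts H \<inter> U"
      proof
        fix w assume w: "w \<in> C"
        then have "w \<in> pverts H" using H(3) q(6)[OF CB(1)] by blast
        then show "w \<in> pverts H \<inter> U" using CB(1)[OF w] BU by auto
      qed
      then have "infinite (pverts H \<inter> U)" using C(2) finite_subset by blast
      then show ?thesis using H by blast
    qed
  next
    fix C assume C: "C \<subseteq> B" "infinite C" "inj_on a C"
    have late: "\<exists>w\<in>C. n \<le> a w" for n
    proof (rule ccontr)
      assume "\<not> (\<exists>w\<in>C. n \<le> a w)"
      then have "a ` C \<subseteq> {..<n}" by (auto simp: not_le)
      then show False using C(2,3) by (meson finite_imageD finite_lessThan finite_subset)
    qed
    have "\<exists>w. \<forall>n. w n \<in> C \<and> b (w n) \<le> a (w (Suc n))"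
    proof (rule dependent_nat_choice)
      show "\<exists>x. x \<in> C" using late by blast
      show "\<exists>y. y \<in> C \<and> b x \<le> a y" for x using late by blast
    qed
    then obtain w where wC: "\<And>n. w n \<in> C" and ba: "\<And>n. b (w n) \<le> a (w (Suc n))" by blast
    have wB: "w n \<in> B" for n using wC C(1) by blast
    have "a (w n) < a (w (Suc n))" for n using q(1)[OF wB[of n]] ba[of n] by simp
    then have "a (w m) < a (w n)" if "m < n" for m n
      using lift_Suc_mono_less[of "\<lambda>n. a (w n)" m n] that by simp
    then have inj_w: "inj w" by (intro linorder_injI) fastforce
    have "\<exists>r. ray (parcs G) r \<and> range r = (\<Union>n. set (q (w n)) \<union> R ` {b (w n)..a (w (Suc n))})"
    proof (rule switch_ray[OF R])
      show "set (q (w m)) \<inter> set (q (w n)) \<subseteq> range R" if "m \<noteq> n" for m n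
        using q_disj[OF wB wB] inj_w that by (simp add: inj_eq)
    qed (use q wB ba in simp_all)
    then obtain r where r: "ray (parcs G) r"
      "range r = (\<Union>n. set (q (w n)) \<union> R ` {b (w n)..a (w (Suc n))})" by blast
    have "w n \<in> range r" for n unfolding r(2) using q(6)[OF wB[of n]] by blast
    then have "range w \<subseteq> U \<inter> range r" using wB BU by auto
    then have "infinite (U \<inter> range r)" using range_inj_infinite[OF inj_w] finite_subset by blast
    then show ?thesis using ray_ladder_or_fan[OF r(1), of U] by blast
  qed
qed

text \<open>
  The ears come from the components of the graph without \<open>R\<close>. If only finitely many of these
  contained vertices of \<open>U\<close>, some \<open>K k\<close> would be disjoint from all of them, as each misses some \<open>K k\<close>
  and these sets decrease; but \<open>K k\<close> contains vertices of \<open>U\<close> outside \<open>R\<close>.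
\<close>

lemma ladder_fan_or_K_2_omega:
  assumes count: "countable (pverts G)" and UV: "U \<subseteq> pverts G" and U: "infinite U"
  shows "\<exists>H. subgraph (with_proj H) (with_proj G) \<and>
    (is_ladder H \<or> is_fan H \<or> is_subdivision_of H K_2_omega) \<and> infinite (pverts H \<inter> U)"
proof (cases "\<exists>X W. finite X \<and> X \<subseteq> pverts G \<and> W \<subseteq> U - X \<and> inj_on (component (parcs G) X) W \<and> infinite W")
  case True
  then obtain X W where "finite X" "X \<subseteq> pverts G" "infinite W" "W \<subseteq> U - X"
    "inj_on (component (parcs G) X) W" by blast
  then show ?thesis using finite_separator_K_2_omega[of X W U] UV by blast
next
  case False
  then have few: "\<forall>X W. finite X \<longrightarrow> X \<subseteq> pverts G \<longrightarrow> W \<subseteq> U - X \<longrightarrow>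
      inj_on (component (parcs G) X) W \<longrightarrow> finite W" by blast
  obtain R K where R: "ray (parcs G) R" and K_Suc: "\<And>k. K (Suc k) \<subseteq> K k" and K_U: "\<And>k. infinite (K k \<inter> U)"
    and closed: "\<And>k x y. x \<in> K k \<Longrightarrow> (x, y) \<in> parcs G \<Longrightarrow> y \<in> K k \<or> y \<in> range R"
    and vanish: "\<And>v. v \<in> pverts G \<Longrightarrow> \<exists>k. v \<notin> K k"
    using vanishing_ray[OF count UV U few] by blast
  note R_eq = ray_eq_iff[OF R]
  let ?C = "component (parcs G) (range R)"
  show ?thesis
  proof (cases "infinite (U \<inter> range R)")
    case True
    then show ?thesis using ray_ladder_or_fan[OF R, of U] by blast
  next
    case finR: False
    define U0 where "U0 = U - range R"
    have K_U0: "infinite (K k \<inter> U0)" for k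
    proof
      assume "finite (K k \<inter> U0)"
      moreover have "K k \<inter> U \<subseteq> (K k \<inter> U0) \<union> (U \<inter> range R)" by (auto simp: U0_def)
      ultimately show False using K_U[of k] finR by (meson finite_UnI finite_subset)
    qed
    have sep: "?C w \<inter> K k = {}" if w: "w \<notin> range R" "w \<notin> K k" for w k
    proof (rule ccontr)
      assume "?C w \<inter> K k \<noteq> {}"
      then obtain z where z: "(w, z) \<in> avoid (parcs G) (range R)" "z \<in> K k" by (auto simp: component_def)
      then have "(z, w) \<in> avoid (parcs G) (range R)" using avoid_sym[OF sym_parcs] by blast
      then have "w \<in> K k" using z(2) by (induction rule: rtrancl_induct) (use closed in auto)
      then show False using w by blast
    qed
    have K_mono: "K n \<subseteq> K m" if "m \<le> n" for m n
      using lift_Suc_antimono_le[of K m n] K_Suc that by blast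
    have "infinite (?C ` U0)"
    proof
      assume fin: "finite (?C ` U0)"
      have "\<forall>Y\<in>?C ` U0. \<exists>k. Y \<inter> K k = {}"
        using sep vanish UV unfolding U0_def by blast
      then obtain k where k: "\<And>Y. Y \<in> ?C ` U0 \<Longrightarrow> Y \<inter> K (k Y) = {}" by metis
      define m where "m = Max (k ` ?C ` U0)"
      obtain w where w: "w \<in> K m" "w \<in> U0" using infinite_imp_nonempty[OF K_U0[of m]] by blast
      have "k (?C w) \<le> m" unfolding m_def by (intro Max_ge finite_imageI imageI fin w(2))
      then have "w \<in> K (k (?C w))" using K_mono w(1) by blast
      moreover have "?C w \<inter> K (k (?C w)) = {}" using w(2) by (intro k imageI)
      moreover have "w \<in> ?C w" by (rule self_in_component)
      ultimately show False by blast
    qed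
    then obtain B where B: "B \<subseteq> U0" "inj_on ?C B" "infinite B"
      using subset_image_inj[of "?C ` U0" ?C U0] by (metis finite_imageI order_refl)
    have BV: "B \<subseteq> pverts G - range R" using B(1) UV by (auto simp: U0_def)
    have R01: "R 0 \<in> range R \<inter> pverts G" "R 1 \<in> range R \<inter> pverts G" "R 0 \<noteq> R 1"
      using ray_in_pverts[OF R] by (auto simp: R_eq)
    obtain e where e: "\<And>w. w \<in> B \<Longrightarrow> ear (parcs G) (range R) (e w) \<and> w \<in> set (e w) \<and> set (e w) \<subseteq> pverts G"
      "\<And>v w. v \<in> B \<Longrightarrow> w \<in> B \<Longrightarrow> v \<noteq> w \<Longrightarrow> set (e v) \<inter> set (e w) \<subseteq> range R"
      using separated_ears[OF R01 BV B(2)] by blast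
    have "\<exists>p i j. i < j \<and> is_path (parcs G) p \<and> hd p = R i \<and> last p = R j \<and> set p = set (e w) \<and>
        set p \<inter> range R \<subseteq> {R i, R j}" if w: "w \<in> B" for w
    proof -
      have ear: "ear (parcs G) (range R) (e w)" using e(1)[OF w] by blast
      then obtain i j where ij: "hd (e w) = R i" "last (e w) = R j" by (auto simp: ear_def)
      then have "i \<noteq> j" using ear by (auto simp: ear_def)
      then consider "i < j" | "j < i" by linarith
      then show ?thesis
      proof cases
        case 1
        then show ?thesis using ear ij unfolding ear_def by metis
      next
        case 2
        have "is_path (parcs G) (rev (e w))" "hd (rev (e w)) = R j" "last (rev (e w)) = R i"
          "set (rev (e w)) = set (e w)"
          using ear ij by (auto simp: ear_def is_path_rev[OF sym_parcs] hd_rev last_rev)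
        moreover have "set (e w) \<inter> range R \<subseteq> {R j, R i}" using ear ij by (auto simp: ear_def)
        ultimately show ?thesis using 2 by metis
      qed
    qed
    then obtain q a b where q0: "\<And>w. w \<in> B \<Longrightarrow> a w < b w \<and> is_path (parcs G) (q w) \<and> hd (q w) = R (a w) \<and>
        last (q w) = R (b w) \<and> set (q w) = set (e w) \<and> set (q w) \<inter> range R \<subseteq> {R (a w), R (b w)}"
      by metis
    have q: "a w < b w" "is_path (parcs G) (q w)" "hd (q w) = R (a w)" "last (q w) = R (b w)"
      "set (q w) \<inter> range R \<subseteq> {R (a w), R (b w)}" "w \<in> set (q w)" "set (q w) \<subseteq> pverts G" if "w \<in> B" for w
      using q0[OF that] e(1)[OF that] by metis+
    have q_disj: "set (q v) \<inter> set (q w) \<subseteq> range R" if "v \<in> B" "w \<in> B" "v \<noteq> w" for v w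
      using e(2)[OF that] q0[OF that(1)] q0[OF that(2)] by simp
    have "B \<subseteq> U - range R" using B(1) by (simp add: U0_def)
    from ears_over_ray[OF R B(3) this q q_disj] show ?thesis .
  qed
qed

end

theorem theorem1p3:
  fixes G :: "'a pair_pre_digraph" and U :: "'a set"
  assumes "pair_bidirected_digraph G"
    and "countable (pverts G)"
    and "k_connected 2 G"
    and "U \<subseteq> pverts G"
    and "infinite U"
  shows "\<exists>H :: 'a pair_pre_digraph.
           subgraph (with_proj H) (with_proj G) \<and>
           (is_ladder H \<or> is_fan H \<or> is_subdivision_of H K_2_omega) \<and>
           infinite (pverts H \<inter> U)"
proof -
  interpret two_connected_graph G using assms(1,3) by (rule two_connected_graph.intro)
  show ?thesis using assms(2,4,5) by (rule ladder_fan_or_K_2_omega)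
qed

end
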